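(* Let $p,q\ge 1$ and $n\ge 2$ be integers, $N=\{1,\dots,n\}$, and let $\mathcal{A}=(a_{i_1\cdots i_pj_1\cdots j_q})\in\mathbb{R}^{[p,q;n,n]}_+$ be a nonnegative rectangular tensor with largest singular value $\lambda_0$. Let $S$ be a nonempty proper subset of $N$ and $\bar S=N\setminus S$. Then $$L^S(\mathcal{A})\le\Theta^S(\mathcal{A})\le\lambda_0\le\Phi^S(\mathcal{A})\le U^S(\mathcal{A}),$$ where $L^S,\Theta^S,\Phi^S,U^S$ are the quantities defined in the context.
   Context: $\mathbb{R}^{[p,q;n,n]}_+$ is the set of arrays $\mathcal{A}=(a_{i_1\cdots i_pj_1\cdots j_q})$ of nonnegative real numbers with all indices in $N=\{1,\dots,n\}$. Put $l=p+q$. Singular values: $\lambda\in\mathbb{C}$ is a singular value of $\mathcal{A}$ if there are $x\in\mathbb{C}^n\setminus\{0\}$ and $y\in\mathbb{C}^n\setminus\{0\}$ with $\mathcal{A}x^{p-1}y^q=\lambda x^{[l-1]}$ and $\mathcal{A}x^py^{q-1}=\lambda y^{[l-1]}$, where $(x^{[l-1]})_i=x_i^{l-1}$, $(y^{[l-1]})_j=y_j^{l-1}$, $$(\mathcal{A}x^{p-1}y^q)_i=\sum_{i_2,\dots,i_p=1}^n\sum_{j_1,\dots,j_q=1}^n a_{ii_2\cdots i_pj_1\cdots j_q}x_{i_2}\cdots x_{i_p}y_{j_1}\cdots y_{j_q},$$ $$(\mathcal{A}x^{p}y^{q-1})_j=\sum_{i_1,\dots,i_p=1}^n\sum_{j_2,\dots,j_q=1}^n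 a_{i_1\cdots i_pjj_2\cdots j_q}x_{i_1}\cdots x_{i_p}y_{j_2}\cdots y_{j_q}.$$ The largest singular value is $\lambda_0=\max\{|\lambda|:\lambda\text{ is a singular value of }\mathcal{A}\}$. Row/column sums: $R_i(\mathcal{A})=\sum_{i_2,\dots,i_p,j_1,\dots,j_q\in N}|a_{ii_2\cdots i_pj_1\cdots j_q}|$ and $C_j(\mathcal{A})=\sum_{i_1,\dots,i_p,j_2,\dots,j_q\in N}|a_{i_1\cdots i_pjj_2\cdots j_q}|$. Write $a_{ij\cdots jj\cdots j}$ for the entry with $i_1=i$ and all other indices ($i_2,\dots,i_p,j_1,\dots,j_q$) equal to $j$, and $a_{j\cdots jij\cdots j}$ for the entry with $j_1=i$ and all other indices ($i_1,\dots,i_p,j_2,\dots,j_q$) equal to $j$. Put $r_i^j(\mathcal{A})=R_i(\mathcal{A})-|a_{ij\cdots jj\cdots j}|$ and $c_i^j(\mathcal{A})=C_i(\mathcal{A})-|a_{j\cdots jij\cdots j}|$. For $T\subseteq N$ let $\Delta^T=\{(i_2,\dots,i_p,j_1,\dots,j_q): \text{all entries in }T\}$, $\Omega^T=\{(i_1,\dots,i_p,j_2,\dots,j_q):\text{all entries in }T\}$, $\overline{\Delta^T}=\Delta^N\setminus\Delta^T$, $\overline{\Omega^T}=\Omega^N\setminus\Omega^T$. For $i,j\in N$, with $\Delta'\in\{\Delta^T,\overline{\Delta^T}\}$ and $\Omega'\in\{\Omega^T,\overline{\Omega^T}\}$, $$r_i^{\Delta'}(\mathcal{A})=\sum_{(i_2,\dots,i_p,j_1,\dots,j_q)\in\Delta'}|a_{ii_2\cdots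 i_pj_1\cdots j_q}|,\qquad c_j^{\Omega'}(\mathcal{A})=\sum_{(i_1,\dots,i_p,j_2,\dots,j_q)\in\Omega'}|a_{i_1\cdots i_pjj_2\cdots j_q}|.$$ In what follows $T\in\{S,\bar S\}$ and $\bar T=N\setminus T$. Definition of $L^S$ and $U^S$: $L^S(\mathcal{A})=\min\{\hat L^S(\mathcal{A}),\hat L^{\bar S}(\mathcal{A}),\tilde L^S(\mathcal{A}),\tilde L^{\bar S}(\mathcal{A})\}$ and $U^S(\mathcal{A})=\max\{\hat U^S(\mathcal{A}),\hat U^{\bar S}(\mathcal{A}),\tilde U^S(\mathcal{A}),\tilde U^{\bar S}(\mathcal{A})\}$, where $$\hat L^T(\mathcal{A})=\min_{i\in T,\,j\in\bar T}\tfrac12\left\{r_i^j(\mathcal{A})+\left[(r_i^j(\mathcal{A}))^2+4a_{ij\cdots jj\cdots j}\min\{R_j(\mathcal{A}),C_j(\mathcal{A})\}\right]^{1/2}\right\},$$ $$\tilde L^T(\mathcal{A})=\min_{i\in T,\,j\in\bar T}\tfrac12\left\{c_i^j(\mathcal{A})+\left[(c_i^j(\mathcal{A}))^2+4a_{j\cdots jij\cdots j}\min\{R_j(\mathcal{A}),C_j(\mathcal{A})\}\right]^{1/2}\right\},$$ $$\hat U^T(\mathcal{A})=\max_{i\in T,\,j\in\bar T}\tfrac12\left\{r_i^j(\mathcal{A})+\left[(r_i^j(\mathcal{A}))^2+4a_{ij\cdots jj\cdots j}\max\{R_j(\mathcal{A}),C_j(\mathcal{A})\}\right]^{1/2}\right\},$$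 $$\tilde U^T(\mathcal{A})=\max_{i\in T,\,j\in\bar T}\tfrac12\left\{c_i^j(\mathcal{A})+\left[(c_i^j(\mathcal{A}))^2+4a_{j\cdots jij\cdots j}\max\{R_j(\mathcal{A}),C_j(\mathcal{A})\}\right]^{1/2}\right\}.$$ Definition of $\Theta^S$ and $\Phi^S$: $\Theta^S(\mathcal{A})=\min\{\hat\Theta^S(\mathcal{A}),\hat\Theta^{\bar S}(\mathcal{A}),\tilde\Theta^S(\mathcal{A}),\tilde\Theta^{\bar S}(\mathcal{A})\}$ and $\Phi^S(\mathcal{A})=\max\{\hat\Phi^S(\mathcal{A}),\hat\Phi^{\bar S}(\mathcal{A}),\tilde\Phi^S(\mathcal{A}),\tilde\Phi^{\bar S}(\mathcal{A})\}$, where $$\hat\Phi^T(\mathcal{A})=\max_{i\in T,\,j\in\bar T}\tfrac12\left\{r_j^{\overline{\Delta^T}}(\mathcal{A})+\left[(r_j^{\overline{\Delta^T}}(\mathcal{A}))^2+4r_j^{\Delta^T}(\mathcal{A})\max\{R_i(\mathcal{A}),C_i(\mathcal{A})\}\right]^{1/2}\right\},$$ $$\tilde\Phi^T(\mathcal{A})=\max_{i\in T,\,j\in\bar T}\tfrac12\left\{c_j^{\overline{\Omega^T}}(\mathcal{A})+\left[(c_j^{\overline{\Omega^T}}(\mathcal{A}))^2+4c_j^{\Omega^T}(\mathcal{A})\max\{R_i(\mathcal{A}),C_i(\mathcal{A})\}\right]^{1/2}\right\},$$ $$\hat\Theta^T(\mathcal{A})=\min_{i\in T,\,j\in\bar T}\tfrac12\left\{r_j^{\overline{\Delta^T}}(\mathcal{A})+\left[(r_j^{\overline{\Delta^T}}(\mathcal{A}))^2+4r_j^{\Delta^T}(\mathcal{A})\min\{R_i(\mathcal{A}),C_i(\mathcal{A})\}\right]^{1/2}\right\},$$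 $$\tilde\Theta^T(\mathcal{A})=\min_{i\in T,\,j\in\bar T}\tfrac12\left\{c_j^{\overline{\Omega^T}}(\mathcal{A})+\left[(c_j^{\overline{\Omega^T}}(\mathcal{A}))^2+4c_j^{\Omega^T}(\mathcal{A})\min\{R_i(\mathcal{A}),C_i(\mathcal{A})\}\right]^{1/2}\right\}.$$ *)

theory Defs
  imports "HOL-Analysis.Analysis"
begin

text \<open>
  The index set \<open>N\<close> is the universe of a finite type \<open>'n\<close>, so \<open>n = CARD('n)\<close>. The entry
  $a_{i_1\cdots i_p j_1\cdots j_q}$ of a rectangular tensor is
  \<open>A [i1, ..., ip] [j1, ..., jq]\<close>; the values of \<open>A\<close> on lists of other lengths are never used.
\<close>

type_synonym 'n rtensor = "'n list \<Rightarrow> 'n list \<Rightarrow> real"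

definition tuples :: "nat \<Rightarrow> 'n set \<Rightarrow> 'n list set" where
  "tuples k T = {is. set is \<subseteq> T \<and> length is = k}"

definition nonneg_rtensor :: "nat \<Rightarrow> nat \<Rightarrow> 'n rtensor \<Rightarrow> bool" where
  "nonneg_rtensor p q A \<longleftrightarrow> (\<forall>is\<in>tuples p UNIV. \<forall>js\<in>tuples q UNIV. A is js \<ge> 0)"

definition monom_at :: "complex ^ 'n \<Rightarrow> 'n list \<Rightarrow> complex" where
  "monom_at x is = (\<Prod>i\<leftarrow>is. x $ i)"

definition vec_power :: "complex ^ 'n \<Rightarrow> nat \<Rightarrow> complex ^ 'n" where
  "vec_power x k = (\<chi> i. (x $ i) ^ k)"

text \<open>$\mathcal{A}x^{p-1}y^q$ and $\mathcal{A}x^py^{q-1}$\<close>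

definition contract_row ::
  "nat \<Rightarrow> nat \<Rightarrow> 'n::finite rtensor \<Rightarrow> complex ^ 'n \<Rightarrow> complex ^ 'n \<Rightarrow> complex ^ 'n" where
  "contract_row p q A x y =
    (\<chi> i. \<Sum>is\<in>tuples (p - 1) UNIV. \<Sum>js\<in>tuples q UNIV.
      complex_of_real (A (i # is) js) * monom_at x is * monom_at y js)"

definition contract_col ::
  "nat \<Rightarrow> nat \<Rightarrow> 'n::finite rtensor \<Rightarrow> complex ^ 'n \<Rightarrow> complex ^ 'n \<Rightarrow> complex ^ 'n" where
  "contract_col p q A x y =
    (\<chi> j. \<Sum>is\<in>tuples p UNIV. \<Sum>js\<in>tuples (q - 1) UNIV.
      complex_of_real (A is (j # js)) * monom_at x is * monom_at y js)"

definition singular_value :: "nat \<Rightarrow> nat \<Rightarrow> 'n::finite rtensor \<Rightarrow> complex \<Rightarrow> bool" where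
  "singular_value p q A \<mu> \<longleftrightarrow>
    (\<exists>x y. x \<noteq> 0 \<and> y \<noteq> 0 \<and>
      contract_row p q A x y = \<mu> *s vec_power x (p + q - 1) \<and>
      contract_col p q A x y = \<mu> *s vec_power y (p + q - 1))"

text \<open>
  The maximum is taken with \<open>GREATEST\<close>, which is meaningful exactly when the maximum is
  attained; unlike \<open>Max\<close> it does not require the set of singular values to be finite.
\<close>

definition largest_singular_value :: "nat \<Rightarrow> nat \<Rightarrow> 'n::finite rtensor \<Rightarrow> real" where
  "largest_singular_value p q A = (GREATEST r. r \<in> cmod ` {\<mu>. singular_value p q A \<mu>})"

definition Delta :: "nat \<Rightarrow> nat \<Rightarrow> 'n set \<Rightarrow> ('n list \<times> 'n list) set" where
  "Delta p q T = tuples (p - 1) T \<times> tuples q T"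

definition Omega :: "nat \<Rightarrow> nat \<Rightarrow> 'n set \<Rightarrow> ('n list \<times> 'n list) set" where
  "Omega p q T = tuples p T \<times> tuples (q - 1) T"

definition Delta_compl :: "nat \<Rightarrow> nat \<Rightarrow> 'n set \<Rightarrow> ('n list \<times> 'n list) set" where
  "Delta_compl p q T = Delta p q UNIV - Delta p q T"

definition Omega_compl :: "nat \<Rightarrow> nat \<Rightarrow> 'n set \<Rightarrow> ('n list \<times> 'n list) set" where
  "Omega_compl p q T = Omega p q UNIV - Omega p q T"

definition row_part :: "'n rtensor \<Rightarrow> ('n list \<times> 'n list) set \<Rightarrow> 'n \<Rightarrow> real" where
  "row_part A D i = (\<Sum>(is, js)\<in>D. \<bar>A (i # is) js\<bar>)"

definition col_part :: "'n rtensor \<Rightarrow> ('n list \<times> 'n list) set \<Rightarrow> 'n \<Rightarrow> real" where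
  "col_part A W j = (\<Sum>(is, js)\<in>W. \<bar>A is (j # js)\<bar>)"

definition row_sum :: "nat \<Rightarrow> nat \<Rightarrow> 'n rtensor \<Rightarrow> 'n \<Rightarrow> real" where
  "row_sum p q A i = row_part A (Delta p q UNIV) i"

definition col_sum :: "nat \<Rightarrow> nat \<Rightarrow> 'n rtensor \<Rightarrow> 'n \<Rightarrow> real" where
  "col_sum p q A j = col_part A (Omega p q UNIV) j"

text \<open>$a_{ij\cdots jj\cdots j}$ and $a_{j\cdots jij\cdots j}$\<close>

definition row_entry :: "nat \<Rightarrow> nat \<Rightarrow> 'n rtensor \<Rightarrow> 'n \<Rightarrow> 'n \<Rightarrow> real" where
  "row_entry p q A i j = A (i # replicate (p - 1) j) (replicate q j)"

definition col_entry :: "nat \<Rightarrow> nat \<Rightarrow> 'n rtensor \<Rightarrow> 'n \<Rightarrow> 'n \<Rightarrow> real" where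
  "col_entry p q A i j = A (replicate p j) (i # replicate (q - 1) j)"

text \<open>$r_i^j$ and $c_i^j$\<close>

definition row_rest :: "nat \<Rightarrow> nat \<Rightarrow> 'n rtensor \<Rightarrow> 'n \<Rightarrow> 'n \<Rightarrow> real" where
  "row_rest p q A i j = row_sum p q A i - \<bar>row_entry p q A i j\<bar>"

definition col_rest :: "nat \<Rightarrow> nat \<Rightarrow> 'n rtensor \<Rightarrow> 'n \<Rightarrow> 'n \<Rightarrow> real" where
  "col_rest p q A i j = col_sum p q A i - \<bar>col_entry p q A i j\<bar>"

definition min_sum :: "nat \<Rightarrow> nat \<Rightarrow> 'n rtensor \<Rightarrow> 'n \<Rightarrow> real" where
  "min_sum p q A i = min (row_sum p q A i) (col_sum p q A i)"

definition max_sum :: "nat \<Rightarrow> nat \<Rightarrow> 'n rtensor \<Rightarrow> 'n \<Rightarrow> real" where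
  "max_sum p q A i = max (row_sum p q A i) (col_sum p q A i)"

text \<open>the larger root of $z^2 - rz - am = 0$\<close>

definition half_root :: "real \<Rightarrow> real \<Rightarrow> real \<Rightarrow> real" where
  "half_root r a m = 1 / 2 * (r + sqrt (r\<^sup>2 + 4 * a * m))"

definition L_hat :: "nat \<Rightarrow> nat \<Rightarrow> 'n::finite rtensor \<Rightarrow> 'n set \<Rightarrow> real" where
  "L_hat p q A T = (MIN (i, j)\<in>T \<times> - T.
    half_root (row_rest p q A i j) (row_entry p q A i j) (min_sum p q A j))"

definition L_tilde :: "nat \<Rightarrow> nat \<Rightarrow> 'n::finite rtensor \<Rightarrow> 'n set \<Rightarrow> real" where
  "L_tilde p q A T = (MIN (i, j)\<in>T \<times> - T.
    half_root (col_rest p q A i j) (col_entry p q A i j) (min_sum p q A j))"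

definition U_hat :: "nat \<Rightarrow> nat \<Rightarrow> 'n::finite rtensor \<Rightarrow> 'n set \<Rightarrow> real" where
  "U_hat p q A T = (MAX (i, j)\<in>T \<times> - T.
    half_root (row_rest p q A i j) (row_entry p q A i j) (max_sum p q A j))"

definition U_tilde :: "nat \<Rightarrow> nat \<Rightarrow> 'n::finite rtensor \<Rightarrow> 'n set \<Rightarrow> real" where
  "U_tilde p q A T = (MAX (i, j)\<in>T \<times> - T.
    half_root (col_rest p q A i j) (col_entry p q A i j) (max_sum p q A j))"

definition Theta_hat :: "nat \<Rightarrow> nat \<Rightarrow> 'n::finite rtensor \<Rightarrow> 'n set \<Rightarrow> real" where
  "Theta_hat p q A T = (MIN (i, j)\<in>T \<times> - T.
    half_root (row_part A (Delta_compl p q T) j) (row_part A (Delta p q T) j) (min_sum p q A i))"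

definition Theta_tilde :: "nat \<Rightarrow> nat \<Rightarrow> 'n::finite rtensor \<Rightarrow> 'n set \<Rightarrow> real" where
  "Theta_tilde p q A T = (MIN (i, j)\<in>T \<times> - T.
    half_root (col_part A (Omega_compl p q T) j) (col_part A (Omega p q T) j) (min_sum p q A i))"

definition Phi_hat :: "nat \<Rightarrow> nat \<Rightarrow> 'n::finite rtensor \<Rightarrow> 'n set \<Rightarrow> real" where
  "Phi_hat p q A T = (MAX (i, j)\<in>T \<times> - T.
    half_root (row_part A (Delta_compl p q T) j) (row_part A (Delta p q T) j) (max_sum p q A i))"

definition Phi_tilde :: "nat \<Rightarrow> nat \<Rightarrow> 'n::finite rtensor \<Rightarrow> 'n set \<Rightarrow> real" where
  "Phi_tilde p q A T = (MAX (i, j)\<in>T \<times> - T.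
    half_root (col_part A (Omega_compl p q T) j) (col_part A (Omega p q T) j) (max_sum p q A i))"

definition L_bound :: "nat \<Rightarrow> nat \<Rightarrow> 'n::finite rtensor \<Rightarrow> 'n set \<Rightarrow> real" where
  "L_bound p q A S =
    Min {L_hat p q A S, L_hat p q A (- S), L_tilde p q A S, L_tilde p q A (- S)}"

definition U_bound :: "nat \<Rightarrow> nat \<Rightarrow> 'n::finite rtensor \<Rightarrow> 'n set \<Rightarrow> real" where
  "U_bound p q A S =
    Max {U_hat p q A S, U_hat p q A (- S), U_tilde p q A S, U_tilde p q A (- S)}"

definition Theta_bound :: "nat \<Rightarrow> nat \<Rightarrow> 'n::finite rtensor \<Rightarrow> 'n set \<Rightarrow> real" where
  "Theta_bound p q A S =
    Min {Theta_hat p q A S, Theta_hat p q A (- S), Theta_tilde p q A S, Theta_tilde p q A (- S)}"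

definition Phi_bound :: "nat \<Rightarrow> nat \<Rightarrow> 'n::finite rtensor \<Rightarrow> 'n set \<Rightarrow> real" where
  "Phi_bound p q A S =
    Max {Phi_hat p q A S, Phi_hat p q A (- S), Phi_tilde p q A S, Phi_tilde p q A (- S)}"

end

theory Submission
  imports Defs
begin

text \<open>
  Put \<open>l = p + q\<close> and think of the equations for a singular value as one eigenvalue problem
  for the order preserving map \<open>(x, y) \<mapsto> (A x^(p-1) y^q, A x^p y^(q-1))\<close>, which is homogeneous of
  degree \<open>l - 1\<close>. Nonlinear Perron-Frobenius theory then controls \<open>\<lambda>\<^sub>0\<close>.

  \<^item> \<^emph>\<open>The bound \<open>\<Phi>\<close>.\<close> Taking moduli in the equations of a singular value \<open>\<mu>\<close> gives
    nonnegative vectors with \<open>\<bar>\<mu>\<bar> x^[l-1] \<le> A x^(p-1) y^q\<close> and the same for \<open>y\<close>. Let \<open>b\<close> be the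
    largest entry of \<open>x\<close> and \<open>y\<close>, at an index \<open>j\<close> that lies, say, outside \<open>T\<close>, and let \<open>a\<close> be the
    largest entry over \<open>T\<close>, at an index \<open>i\<close>. The inequality at \<open>j\<close> bounds \<open>\<bar>\<mu>\<bar> b^(l-1)\<close> by a
    combination of \<open>a^(l-1)\<close> and \<open>b^(l-1)\<close>, the one at \<open>i\<close> bounds \<open>\<bar>\<mu>\<bar> a^(l-1)\<close> by a multiple of
    \<open>b^(l-1)\<close>, and eliminating the ratio \<open>a / b\<close> leaves the quadratic inequality whose root is
    \<open>half_root\<close> (\<open>two_level_upper\<close>, \<open>sub_pair_le_Phi_bound\<close>).

  \<^item> \<^emph>\<open>The bound \<open>\<Theta>\<close>.\<close> The mirror argument, with minima instead of maxima, needs positive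
    vectors: every \<open>t\<close> admitting \<open>x, y > 0\<close> with \<open>A x^(p-1) y^q \<le> t x^[l-1]\<close> and
    \<open>A x^p y^(q-1) \<le> t y^[l-1]\<close> is at least \<open>\<Theta>\<close> (\<open>super_pair_ge_Theta_bound\<close>). By comparison it is
    also at least \<open>\<bar>\<mu>\<bar>\<close> for every singular value \<open>\<mu>\<close> (\<open>sub_pair_le_super_pair\<close>). So it is enough to
    have one singular value that is at least every lower bound of all such \<open>t\<close>; this
    singular value is then \<open>\<lambda>\<^sub>0\<close>, and in particular the maximum exists. It is found by adding
    \<open>\<epsilon>\<close> to all entries, applying Brouwer's theorem to the resulting positive tensor, and letting
    \<open>\<epsilon> \<rightarrow> 0\<close> (\<open>perron_singular_value\<close>).

  \<^item> \<^emph>\<open>The comparison with \<open>L\<close> and \<open>U\<close>.\<close> All four bounds are extrema of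
    \<open>g(R, a, m) = half_root (R - a) a m\<close> with \<open>0 \<le> a \<le> R\<close>. As \<open>a\<close> runs from \<open>0\<close> to \<open>R\<close>, \<open>g\<close> moves
    monotonically from \<open>R\<close> to \<open>sqrt (R m)\<close>, that is, towards \<open>m\<close>. A term of \<open>\<Phi>\<close> at \<open>(i, j)\<close> is
    \<open>g(R_j, b, m_i)\<close> and \<open>U\<close> has the term \<open>g(R_j, b', m_i)\<close> with \<open>b' \<le> b\<close>. This one dominates if
    \<open>m_i \<le> R_j\<close>. Otherwise the roles of \<open>i\<close> and \<open>j\<close> are exchanged: \<open>g(R_j, b, m_i) \<le> sqrt (R_j m_i)\<close>,
    while the row or column sum of \<open>i\<close> that attains \<open>m_i\<close> gives a term \<open>g(m_i, c, m_j)\<close> of \<open>U\<close> that is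
    at least \<open>min m_i (sqrt (m_i m_j))\<close>, and \<open>m_j \<ge> R_j\<close> (\<open>half_root_upper_swap\<close>,
    \<open>Phi_hat_le_U_bound\<close>). The comparison of \<open>L\<close> with \<open>\<Theta>\<close> is the mirror image.

  Rows and columns are interchanged by \<open>flip_tensor\<close>, so that only rows need to be treated.
\<close>

section \<open>Interchanging rows and columns\<close>

definition flip_tensor :: "'n rtensor \<Rightarrow> 'n rtensor" where
  "flip_tensor A is js = A js is"

lemma flip_flip [simp]: "flip_tensor (flip_tensor A) = A"
  by (simp add: flip_tensor_def fun_eq_iff)

lemma nonneg_flip: "nonneg_rtensor q p (flip_tensor A) \<longleftrightarrow> nonneg_rtensor p q A"
  by (auto simp: nonneg_rtensor_def flip_tensor_def)

lemma swap_Delta: "Omega p q T = prod.swap ` Delta q p T"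
  by (auto simp: Omega_def Delta_def)

lemma swap_Delta_compl: "Omega_compl p q T = prod.swap ` Delta_compl q p T"
  by (auto simp: Omega_compl_def Delta_compl_def swap_Delta)

lemma col_part_swap: "col_part A (prod.swap ` D) j = row_part (flip_tensor A) D j"
  unfolding col_part_def row_part_def flip_tensor_def
  by (subst sum.reindex) (auto intro: sum.cong simp: case_prod_unfold)

lemma flip_col_sum: "col_sum p q A j = row_sum q p (flip_tensor A) j"
  by (simp add: col_sum_def row_sum_def swap_Delta col_part_swap)

lemma flip_col_entry: "col_entry p q A i j = row_entry q p (flip_tensor A) i j"
  by (simp add: col_entry_def row_entry_def flip_tensor_def)

lemma flip_col_rest: "col_rest p q A i j = row_rest q p (flip_tensor A) i j"
  by (simp add: col_rest_def row_rest_def flip_col_sum flip_col_entry)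

lemma flip_min_sum: "min_sum q p (flip_tensor A) i = min_sum p q A i"
  by (simp add: min_sum_def flip_col_sum min.commute)

lemma flip_max_sum: "max_sum q p (flip_tensor A) i = max_sum p q A i"
  by (simp add: max_sum_def flip_col_sum max.commute)

lemma
  shows flip_L: "L_tilde p q A T = L_hat q p (flip_tensor A) T"
    and flip_U: "U_tilde p q A T = U_hat q p (flip_tensor A) T"
    and flip_Theta: "Theta_tilde p q A T = Theta_hat q p (flip_tensor A) T"
    and flip_Phi: "Phi_tilde p q A T = Phi_hat q p (flip_tensor A) T"
  unfolding L_tilde_def L_hat_def U_tilde_def U_hat_def Theta_tilde_def Theta_hat_def
    Phi_tilde_def Phi_hat_def
  by (simp_all add: flip_col_rest flip_col_entry flip_min_sum flip_max_sum
      swap_Delta swap_Delta_compl col_part_swap)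

lemma Phi_bound_flip: "Phi_bound q p (flip_tensor A) S = Phi_bound p q A S"
  by (simp add: Phi_bound_def flip_Phi ac_simps)

lemma Theta_bound_flip: "Theta_bound q p (flip_tensor A) S = Theta_bound p q A S"
  by (simp add: Theta_bound_def flip_Theta ac_simps)

lemma U_bound_flip: "U_bound q p (flip_tensor A) S = U_bound p q A S"
  by (simp add: U_bound_def flip_U ac_simps)

lemma L_bound_flip: "L_bound q p (flip_tensor A) S = L_bound p q A S"
  by (simp add: L_bound_def flip_L ac_simps)

lemma U_bound_Compl: "U_bound p q A (- S) = U_bound p q A S"
  by (simp add: U_bound_def ac_simps)

lemma L_bound_Compl: "L_bound p q A (- S) = L_bound p q A S"
  by (simp add: L_bound_def ac_simps)

section \<open>The larger root of the quadratic equation\<close>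

lemma half_root_root:
  assumes "r \<ge> 0" "a \<ge> 0" "m \<ge> 0"
  shows "half_root r a m ^ 2 = r * half_root r a m + a * m" "half_root r a m \<ge> r"
proof -
  define s where "s = sqrt (r\<^sup>2 + 4 * a * m)"
  have "s\<^sup>2 = r\<^sup>2 + 4 * a * m" using assms by (simp add: s_def)
  thus "half_root r a m ^ 2 = r * half_root r a m + a * m"
    unfolding half_root_def s_def[symmetric] by (simp add: power2_eq_square algebra_simps)
  have "s \<ge> r" unfolding s_def using assms by (intro real_le_rsqrt) simp
  thus "half_root r a m \<ge> r"
    unfolding half_root_def s_def[symmetric] by simp
qed

lemma le_half_root:
  assumes "r \<ge> 0" "a \<ge> 0" "m \<ge> 0" "z \<ge> 0" "z\<^sup>2 \<le> r * z + a * m"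
  shows "z \<le> half_root r a m"
proof (rule ccontr)
  define h where "h = half_root r a m"
  have h: "h^2 = r * h + a * m" "h \<ge> r" using half_root_root assms unfolding h_def by auto
  assume "\<not> z \<le> half_root r a m"
  hence "z > h" by (simp add: h_def)
  have "0 < (z - h) * (z + h - r)"
    using \<open>z > h\<close> h(2) assms by (intro mult_pos_pos) linarith+
  thus False using h assms by (simp add: power2_eq_square algebra_simps)
qed

lemma half_root_le:
  assumes "r \<ge> 0" "a \<ge> 0" "m \<ge> 0" "z \<ge> r" "z\<^sup>2 \<ge> r * z + a * m"
  shows "half_root r a m \<le> z"
proof (cases "z = 0")
  case True
  thus ?thesis using assms by (simp add: half_root_def)
next
  case False
  define h where "h = half_root r a m"
  have h: "h^2 = r * h + a * m" "h \<ge> r" using half_root_root assms unfolding h_def by auto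
  show ?thesis
  proof (rule ccontr)
    assume "\<not> ?thesis"
    hence "h > z" by (simp add: h_def)
    have "0 < (h - z) * (z + h - r)"
      using \<open>h > z\<close> h(2) assms False by (intro mult_pos_pos) linarith+
    thus False using h assms by (simp add: power2_eq_square algebra_simps)
  qed
qed

text \<open>
  With \<open>z = min R m\<close> the inequality \<open>z\<^sup>2 \<le> (R - a) z + a m\<close> holds because \<open>z \<le> R\<close> and \<open>z \<le> m\<close>; so
  \<open>half_root (R - a) a m\<close> lies between \<open>R\<close> and \<open>m\<close>, the other side being dual.
\<close>
lemma half_root_ge_min:
  assumes "0 \<le> a" "a \<le> R" "0 \<le> m"
  shows "min R m \<le> half_root (R - a) a m"
proof (rule le_half_root)
  have "min R m * min R m \<le> (R - a) * min R m + a * min R m"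
    by (simp add: algebra_simps)
       (use assms in \<open>simp add: mult_right_mono\<close>)
  also have "a * min R m \<le> a * m" using assms by (intro mult_left_mono) auto
  finally show "(min R m)\<^sup>2 \<le> (R - a) * min R m + a * m" by (simp add: power2_eq_square)
qed (use assms in auto)

lemma half_root_le_max:
  assumes "0 \<le> a" "a \<le> R" "0 \<le> m"
  shows "half_root (R - a) a m \<le> max R m"
proof (rule half_root_le)
  have "a * m \<le> a * max R m" using assms by (intro mult_left_mono) auto
  also have "(R - a) * max R m + a * max R m \<le> max R m * max R m"
    using assms mult_right_mono[of R "max R m" "max R m"] by (simp add: algebra_simps)
  finally show "(R - a) * max R m + a * m \<le> (max R m)\<^sup>2" by (simp add: power2_eq_square)
qed (use assms in auto)

text \<open>
  The defining equation reads \<open>z\<^sup>2 - R z = a (m - z)\<close>. As \<open>z\<close> lies between \<open>R\<close> and \<open>m\<close>, the sign of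
  \<open>m - z\<close> is that of \<open>m - R\<close>, which decides in which direction the weight \<open>a\<close> moves the root.
\<close>
lemma half_root_mono_weight:
  assumes "0 \<le> a" "a \<le> b" "b \<le> R" "R \<le> m"
  shows "half_root (R - a) a m \<le> half_root (R - b) b m"
proof (rule le_half_root)
  define h where "h = half_root (R - a) a m"
  have h: "h\<^sup>2 = (R - a) * h + a * m" and "h \<ge> R - a" "h \<le> m"
    using half_root_root[of "R - a" a m] half_root_le_max[of a R m] assms
    unfolding h_def by auto
  have "0 \<le> (b - a) * (m - h)" using assms \<open>h \<le> m\<close> by simp
  thus "h\<^sup>2 \<le> (R - b) * h + b * m" unfolding h by (simp add: algebra_simps)
  show "h \<ge> 0" using assms \<open>h \<ge> R - a\<close> by simp
qed (use assms in auto)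

lemma half_root_antimono_weight:
  assumes "0 \<le> a" "a \<le> b" "b \<le> R" "m \<le> R" "0 \<le> m"
  shows "half_root (R - b) b m \<le> half_root (R - a) a m"
proof (rule le_half_root)
  define h where "h = half_root (R - b) b m"
  have h: "h\<^sup>2 = (R - b) * h + b * m" and "h \<ge> R - b" "h \<ge> m"
    using half_root_root[of "R - b" b m] half_root_ge_min[of b R m] assms
    unfolding h_def by auto
  have "0 \<le> (b - a) * (h - m)" using assms \<open>h \<ge> m\<close> by simp
  thus "h\<^sup>2 \<le> (R - a) * h + a * m" unfolding h by (simp add: algebra_simps)
  show "h \<ge> 0" using assms \<open>h \<ge> R - b\<close> by simp
qed (use assms in auto)

lemma half_root_full_weight: "half_root 0 R m = sqrt (R * m)"
  by (simp add: half_root_def real_sqrt_mult)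

text \<open>
  The geometric mean \<open>sqrt (R * m)\<close> separates the two roots: it is the left root at full weight \<open>b = R\<close>,
  and the right root is at least \<open>min m (sqrt (m * M))\<close>, its value at one of the extreme weights. This
  is what allows the two indices of a pair to change roles in the comparison of the bounds.
\<close>
lemma half_root_upper_swap:
  assumes "0 \<le> b" "b \<le> R" "R \<le> m" "R \<le> M" "0 \<le> c" "c \<le> m"
  shows "half_root (R - b) b m \<le> half_root (m - c) c M"
proof -
  have "half_root (R - b) b m \<le> sqrt (R * m)"
    using half_root_mono_weight[of b R R m] assms by (simp add: half_root_full_weight)
  also have "sqrt (R * m) \<le> half_root (m - c) c M"
  proof (cases "M \<le> m")
    case True
    have "sqrt (R * m) \<le> sqrt (m * M)"
      using assms by (subst mult.commute) (auto intro!: mult_left_mono)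
    also have "\<dots> \<le> half_root (m - c) c M"
      using half_root_antimono_weight[of c m m M] True assms by (simp add: half_root_full_weight)
    finally show ?thesis .
  next
    case False
    have "sqrt (R * m) \<le> sqrt (m * m)"
      by (intro real_sqrt_le_mono mult_right_mono) (use assms in auto)
    also have "\<dots> = m" using assms by simp
    also have "\<dots> \<le> half_root (m - c) c M"
      using half_root_ge_min[of c m M] False assms by simp
    finally show ?thesis .
  qed
  finally show ?thesis .
qed

lemma half_root_lower_swap:
  assumes "0 \<le> b" "b \<le> R" "m \<le> R" "M \<le> R" "0 \<le> M" "0 \<le> c" "c \<le> m"
  shows "half_root (m - c) c M \<le> half_root (R - b) b m"
proof -
  have "half_root (m - c) c M \<le> sqrt (R * m)"
  proof (cases "m \<le> M")
    case True
    have "half_root (m - c) c M \<le> sqrt (m * M)"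
      using half_root_mono_weight[of c m m M] True assms by (simp add: half_root_full_weight)
    also have "\<dots> \<le> sqrt (R * m)"
      using assms by (subst mult.commute) (auto intro!: mult_right_mono)
    finally show ?thesis .
  next
    case False
    have "half_root (m - c) c M \<le> m"
      using half_root_le_max[of c m M] False assms by simp
    also have "\<dots> = sqrt (m * m)" using assms by simp
    also have "\<dots> \<le> sqrt (R * m)"
      by (intro real_sqrt_le_mono mult_right_mono) (use assms in auto)
    finally show ?thesis .
  qed
  also have "sqrt (R * m) \<le> half_root (R - b) b m"
    using half_root_antimono_weight[of b R R m] assms by (simp add: half_root_full_weight)
  finally show ?thesis .
qed

section \<open>Partial row sums and single entries\<close>

lemma finite_tuples: "finite (tuples k (T :: 'n::finite set))"
  unfolding tuples_def by (rule finite_lists_length_eq) simp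

lemma finite_Delta: "finite (Delta p q (T :: 'n::finite set))"
  by (simp add: Delta_def finite_tuples)

lemma Delta_compl_row_part:
  fixes T :: "'n::finite set"
  shows "row_part A (Delta_compl p q T) i = row_sum p q A i - row_part A (Delta p q T) i"
proof -
  have "Delta p q T \<subseteq> Delta p q UNIV" by (auto simp: Delta_def tuples_def)
  thus ?thesis unfolding row_part_def row_sum_def Delta_compl_def
    by (subst sum_diff) (auto simp: finite_Delta)
qed

lemma row_part_nonneg: "row_part A D i \<ge> 0"
  unfolding row_part_def by (rule sum_nonneg) auto

lemma row_part_le_row_sum:
  fixes T :: "'n::finite set"
  shows "row_part A (Delta p q T) i \<le> row_sum p q A i"
  using row_part_nonneg[of A "Delta_compl p q T" i] Delta_compl_row_part[of A p q T i] by simp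

lemma row_entry_nonneg: "nonneg_rtensor p q A \<Longrightarrow> p \<ge> 1 \<Longrightarrow> row_entry p q A i j \<ge> 0"
  by (auto simp: nonneg_rtensor_def row_entry_def tuples_def)

lemma abs_row_entry_le_row_part:
  fixes T :: "'n::finite set"
  assumes "j \<in> T"
  shows "\<bar>row_entry p q A i j\<bar> \<le> row_part A (Delta p q T) i"
proof -
  have "(replicate (p - 1) j, replicate q j) \<in> Delta p q T"
    using assms by (auto simp: Delta_def tuples_def)
  from member_le_sum[OF this, of "\<lambda>(is, js). \<bar>A (i # is) js\<bar>"]
  show ?thesis by (auto simp: row_part_def row_entry_def finite_Delta)
qed

lemma row_sum_nonneg: "row_sum p q A i \<ge> 0"
  by (simp add: row_sum_def row_part_nonneg)

lemma max_sum_ge: "row_sum p q A i \<le> max_sum p q A i"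
  by (simp add: max_sum_def)

lemma min_sum_le: "min_sum p q A i \<le> row_sum p q A i"
  by (simp add: min_sum_def)

lemma min_sum_nonneg: "min_sum p q A i \<ge> 0"
  by (simp add: min_sum_def row_sum_nonneg flip_col_sum)

lemma row_entry_bounds:
  assumes "nonneg_rtensor p q A" "p \<ge> 1"
  shows "0 \<le> row_entry p q A i j" "row_entry p q (A :: 'n::finite rtensor) i j \<le> row_sum p q A i"
  using abs_row_entry_le_row_part[of j UNIV p q A i] row_entry_nonneg[OF assms]
  by (auto simp: row_sum_def)

section \<open>Comparison of the two pairs of bounds\<close>

lemma U_hat_ge:
  assumes "i \<in> T" "j \<notin> T" "nonneg_rtensor p q A" "p \<ge> 1"
  shows "half_root (row_sum p q A i - row_entry p q A i j) (row_entry p q A i j) (max_sum p q A j)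
    \<le> U_hat p q A T"
  unfolding U_hat_def using assms row_entry_bounds(1)[OF assms(3,4), of i j]
  by (intro Max_ge) (auto simp: row_rest_def intro!: image_eqI[of _ _ "(i, j)"])

lemma L_hat_le:
  assumes "i \<in> T" "j \<notin> T" "nonneg_rtensor p q A" "p \<ge> 1"
  shows "L_hat p q A T \<le>
    half_root (row_sum p q A i - row_entry p q A i j) (row_entry p q A i j) (min_sum p q A j)"
  unfolding L_hat_def using assms row_entry_bounds(1)[OF assms(3,4), of i j]
  by (intro Min_le) (auto simp: row_rest_def intro!: image_eqI[of _ _ "(i, j)"])

text \<open>
  The term at \<open>(i, j)\<close> of \<open>Phi_hat\<close> is dominated by the term of \<open>U_hat\<close> at \<open>(j, i)\<close> or by a term at
  \<open>(i, j)\<close>, according to the order of \<open>max_sum\<close> at \<open>i\<close> and the row sum at \<open>j\<close>. In the second case the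
  term has to come from a row if \<open>max_sum\<close> at \<open>i\<close> is a row sum, and from a column otherwise. The
  remaining three parts of \<open>Phi_bound\<close> follow by symmetry.
\<close>
lemma Phi_hat_le_U_bound:
  fixes A :: "'n::finite rtensor"
  assumes A: "nonneg_rtensor p q A" and p: "p \<ge> 1" and q: "q \<ge> 1" and "S \<noteq> {}" "S \<noteq> UNIV"
  shows "Phi_hat p q A S \<le> U_bound p q A S"
  unfolding Phi_hat_def
proof (rule Max.boundedI, goal_cases)
  case 2
  show ?case using assms by auto
next
  case (3 z)
  then obtain i j where ij: "i \<in> S" "j \<notin> S" and
    z: "z = half_root (row_sum p q A j - row_part A (Delta p q S) j) (row_part A (Delta p q S) j)
              (max_sum p q A i)"
    by (auto simp: Delta_compl_row_part)
  have A': "nonneg_rtensor q p (flip_tensor A)" using A by (simp add: nonneg_flip)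
  show ?case
  proof (cases "max_sum p q A i \<le> row_sum p q A j")
    case True
    have "z \<le> half_root (row_sum p q A j - row_entry p q A j i) (row_entry p q A j i) (max_sum p q A i)"
      unfolding z
      using True abs_row_entry_le_row_part[OF ij(1), of p q A j] row_entry_bounds[OF A p, of j i]
        row_part_le_row_sum[of A p q S j] row_sum_nonneg[of p q A i] max_sum_ge[of p q A i]
      by (intro half_root_antimono_weight) auto
    also have "\<dots> \<le> U_hat p q A (- S)" using ij A p by (intro U_hat_ge) auto
    also have "\<dots> \<le> U_bound p q A S" by (simp add: U_bound_def)
    finally show ?thesis .
  next
    case False
    note * = row_part_nonneg[of A "Delta p q S" j] row_part_le_row_sum[of A p q S j]
        max_sum_ge[of p q A j]
    consider "max_sum p q A i = row_sum p q A i" | "max_sum p q A i = row_sum q p (flip_tensor A) i"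
      by (metis max_sum_def flip_col_sum max_def)
    thus ?thesis
    proof cases
      case 1
      have "z \<le> half_root (row_sum p q A i - row_entry p q A i j) (row_entry p q A i j) (max_sum p q A j)"
        unfolding z 1 using False * row_entry_bounds[OF A p, of i j]
        by (intro half_root_upper_swap) (auto simp: 1)
      also have "\<dots> \<le> U_hat p q A S" using ij A p by (intro U_hat_ge) auto
      also have "\<dots> \<le> U_bound p q A S" by (simp add: U_bound_def)
      finally show ?thesis .
    next
      case 2
      let ?B = "flip_tensor A"
      have "z \<le> half_root (row_sum q p ?B i - row_entry q p ?B i j) (row_entry q p ?B i j)
          (max_sum q p ?B j)"
        unfolding z 2 using False * row_entry_bounds[OF A' q, of i j]
        by (intro half_root_upper_swap) (auto simp: 2 flip_max_sum)
      also have "\<dots> \<le> U_tilde p q A S" unfolding flip_U using ij A' q by (intro U_hat_ge) auto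
      also have "\<dots> \<le> U_bound p q A S" by (simp add: U_bound_def)
      finally show ?thesis .
    qed
  qed
qed auto

lemma L_bound_le_Theta_hat:
  fixes A :: "'n::finite rtensor"
  assumes A: "nonneg_rtensor p q A" and p: "p \<ge> 1" and q: "q \<ge> 1" and "S \<noteq> {}" "S \<noteq> UNIV"
  shows "L_bound p q A S \<le> Theta_hat p q A S"
  unfolding Theta_hat_def
proof (rule Min.boundedI, goal_cases)
  case 2
  show ?case using assms by auto
next
  case (3 z)
  then obtain i j where ij: "i \<in> S" "j \<notin> S" and
    z: "z = half_root (row_sum p q A j - row_part A (Delta p q S) j) (row_part A (Delta p q S) j)
              (min_sum p q A i)"
    by (auto simp: Delta_compl_row_part)
  have A': "nonneg_rtensor q p (flip_tensor A)" using A by (simp add: nonneg_flip)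
  show ?case
  proof (cases "row_sum p q A j \<le> min_sum p q A i")
    case True
    have "L_bound p q A S \<le> L_hat p q A (- S)" by (simp add: L_bound_def)
    also have "\<dots> \<le> half_root (row_sum p q A j - row_entry p q A j i) (row_entry p q A j i) (min_sum p q A i)"
      using ij A p by (intro L_hat_le) auto
    also have "\<dots> \<le> z"
      unfolding z
      using True abs_row_entry_le_row_part[OF ij(1), of p q A j] row_entry_bounds[OF A p, of j i]
        row_part_le_row_sum[of A p q S j] 
      by (intro half_root_mono_weight) auto
    finally show ?thesis .
  next
    case False
    note * = row_part_nonneg[of A "Delta p q S" j] row_part_le_row_sum[of A p q S j]
        min_sum_le[of p q A j] min_sum_nonneg[of p q A j]
    consider "min_sum p q A i = row_sum p q A i" | "min_sum p q A i = row_sum q p (flip_tensor A) i"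
      by (metis min_sum_def flip_col_sum min_def)
    thus ?thesis
    proof cases
      case 1
      have "L_bound p q A S \<le> L_hat p q A S" by (simp add: L_bound_def)
      also have "\<dots> \<le> half_root (row_sum p q A i - row_entry p q A i j) (row_entry p q A i j) (min_sum p q A j)"
        using ij A p by (intro L_hat_le) auto
      also have "\<dots> \<le> z"
        unfolding z 1 using False * row_entry_bounds[OF A p, of i j]
        by (intro half_root_lower_swap) (auto simp: 1)
      finally show ?thesis .
    next
      case 2
      let ?B = "flip_tensor A"
      have "L_bound p q A S \<le> L_tilde p q A S" by (simp add: L_bound_def)
      also have "\<dots> \<le> half_root (row_sum q p ?B i - row_entry q p ?B i j) (row_entry q p ?B i j)
          (min_sum q p ?B j)" unfolding flip_L using ij A' q by (intro L_hat_le) auto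
      also have "\<dots> \<le> z"
        unfolding z 2 using False * row_entry_bounds[OF A' q, of i j]
        by (intro half_root_lower_swap) (auto simp: 2 flip_min_sum)
      finally show ?thesis .
    qed
  qed
qed auto

lemma Phi_bound_le_U_bound:
  fixes A :: "'n::finite rtensor"
  assumes "nonneg_rtensor p q A" "p \<ge> 1" "q \<ge> 1" "S \<noteq> {}" "S \<noteq> UNIV"
  shows "Phi_bound p q A S \<le> U_bound p q A S"
  using Phi_hat_le_U_bound[of p q A S] Phi_hat_le_U_bound[of p q A "- S"]
    Phi_hat_le_U_bound[of q p "flip_tensor A" S] Phi_hat_le_U_bound[of q p "flip_tensor A" "- S"] assms
  by (auto simp: Phi_bound_def flip_Phi U_bound_Compl U_bound_flip nonneg_flip)

lemma L_bound_le_Theta_bound: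
  fixes A :: "'n::finite rtensor"
  assumes "nonneg_rtensor p q A" "p \<ge> 1" "q \<ge> 1" "S \<noteq> {}" "S \<noteq> UNIV"
  shows "L_bound p q A S \<le> Theta_bound p q A S"
  using L_bound_le_Theta_hat[of p q A S] L_bound_le_Theta_hat[of p q A "- S"]
    L_bound_le_Theta_hat[of q p "flip_tensor A" S] L_bound_le_Theta_hat[of q p "flip_tensor A" "- S"] assms
  by (auto simp: Theta_bound_def flip_Theta L_bound_Compl L_bound_flip nonneg_flip)

section \<open>The row and column forms on real vectors\<close>

definition real_monom :: "real ^ 'n \<Rightarrow> 'n list \<Rightarrow> real" where
  "real_monom x is = (\<Prod>i\<leftarrow>is. x $ i)"

definition row_form :: "nat \<Rightarrow> nat \<Rightarrow> 'n::finite rtensor \<Rightarrow> real ^ 'n \<Rightarrow> real ^ 'n \<Rightarrow> 'n \<Rightarrow> real" where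
  "row_form p q A x y i = (\<Sum>(is, js)\<in>Delta p q UNIV. A (i # is) js * (real_monom x is * real_monom y js))"

text \<open>
  Being an abbreviation for a row form of the flipped tensor, the column form needs no facts of its own.
\<close>
abbreviation col_form :: "nat \<Rightarrow> nat \<Rightarrow> 'n::finite rtensor \<Rightarrow> real ^ 'n \<Rightarrow> real ^ 'n \<Rightarrow> 'n \<Rightarrow> real" where
  "col_form p q A x y \<equiv> row_form q p (flip_tensor A) y x"

lemma real_monom_Nil [simp]: "real_monom x [] = 1"
  and real_monom_Cons [simp]: "real_monom x (i # is) = x $ i * real_monom x is"
  by (simp_all add: real_monom_def)

lemma real_monom_nonneg: "(\<And>i. x $ i \<ge> 0) \<Longrightarrow> real_monom x is \<ge> 0"
  by (induction "is") auto

lemma real_monom_pos: "(\<And>i. i \<in> set is \<Longrightarrow> x $ i > 0) \<Longrightarrow> real_monom x is > 0"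
  by (induction "is") auto

lemma real_monom_scale: "real_monom (c *\<^sub>R x) is = c ^ length is * real_monom x is"
  by (induction "is") auto

lemma real_monom_mono:
  assumes "\<And>i. i \<in> set is \<Longrightarrow> 0 \<le> x $ i" "\<And>i. i \<in> set is \<Longrightarrow> x $ i \<le> y $ i"
  shows "0 \<le> real_monom x is \<and> real_monom x is \<le> real_monom y is"
  using assms
proof (induction "is")
  case (Cons i "is")
  have "0 \<le> x $ i" "x $ i \<le> y $ i" "0 \<le> real_monom x is \<and> real_monom x is \<le> real_monom y is"
    using Cons by auto
  thus ?case by (auto intro!: mult_mono)
qed auto

lemma real_monom_const: "real_monom (\<chi> i. c) is = c ^ length is"
  by (induction "is") auto

lemma norm_monom_at: "cmod (monom_at x is) = real_monom (\<chi> i. cmod (x $ i)) is"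
  unfolding monom_at_def real_monom_def by (induction "is") (auto simp: norm_mult)

lemma monom_at_of_real: "monom_at (\<chi> i. of_real (x $ i)) is = of_real (real_monom x is)"
  unfolding monom_at_def real_monom_def by (induction "is") auto

lemma row_form_scale:
  "row_form p q A (c *\<^sub>R x) (d *\<^sub>R y) i = c ^ (p - 1) * d ^ q * row_form p q A x y i"
  unfolding row_form_def sum_distrib_left
  by (intro sum.cong) (auto simp: real_monom_scale Delta_def tuples_def)

lemma nonneg_rtensor_Cons:
  assumes "nonneg_rtensor p q A" "p \<ge> 1" "(is, js) \<in> Delta p q UNIV"
  shows "A (i # is) js \<ge> 0"
  using assms by (auto simp: nonneg_rtensor_def Delta_def tuples_def)

lemma real_monom_mult_mono:
  assumes "\<And>i. 0 \<le> x $ i \<and> x $ i \<le> x' $ i" "\<And>i. 0 \<le> y $ i \<and> y $ i \<le> y' $ i"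
  shows "real_monom x is * real_monom y js \<le> real_monom x' is * real_monom y' js"
proof -
  have "0 \<le> real_monom x is \<and> real_monom x is \<le> real_monom x' is"
    "0 \<le> real_monom y js \<and> real_monom y js \<le> real_monom y' js"
    by (intro real_monom_mono; use assms in blast)+
  thus ?thesis by (intro mult_mono) auto
qed

lemma row_form_mono:
  assumes "nonneg_rtensor p q A" "p \<ge> 1"
    and "\<And>i. 0 \<le> x $ i \<and> x $ i \<le> x' $ i" "\<And>i. 0 \<le> y $ i \<and> y $ i \<le> y' $ i"
  shows "row_form p q A x y i \<le> row_form p q A x' y' i"
  unfolding row_form_def
  by (intro sum_mono) (auto intro!: mult_left_mono real_monom_mult_mono assms
      nonneg_rtensor_Cons[OF assms(1,2)])

lemma row_form_const:
  assumes "nonneg_rtensor p q A" "p \<ge> 1"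
  shows "row_form p q A (\<chi> i. c) (\<chi> i. c) i = row_sum p q A i * c ^ (p + q - 1)"
  unfolding row_form_def row_sum_def row_part_def sum_distrib_right
proof (intro sum.cong refl, clarify)
  fix "is" js assume *: "(is, js) \<in> Delta p q (UNIV :: 'a set)"
  hence "length is + length js = p + q - 1" using assms by (auto simp: Delta_def tuples_def)
  thus "A (i # is) js * (real_monom (\<chi> i. c) is * real_monom (\<chi> i. c) js) =
         \<bar>A (i # is) js\<bar> * c ^ (p + q - 1)"
    using nonneg_rtensor_Cons[OF assms *, of i]
    by (simp add: real_monom_const power_add[symmetric])
qed

lemma row_form_split:
  assumes "nonneg_rtensor p q A" "p \<ge> 1"
  shows "row_form p q A x y i =
    (\<Sum>(is, js)\<in>Delta p q T. \<bar>A (i # is) js\<bar> * (real_monom x is * real_monom y js)) +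
    (\<Sum>(is, js)\<in>Delta_compl p q T. \<bar>A (i # is) js\<bar> * (real_monom x is * real_monom y js))"
proof -
  have "row_form p q A x y i =
    (\<Sum>(is, js)\<in>Delta p q UNIV. \<bar>A (i # is) js\<bar> * (real_monom x is * real_monom y js))"
    unfolding row_form_def
    using nonneg_rtensor_Cons[OF assms] by (intro sum.cong) auto
  also have "Delta p q (UNIV :: 'a set) = Delta p q T \<union> Delta_compl p q T"
    by (auto simp: Delta_compl_def Delta_def tuples_def)
  finally show ?thesis
    by (subst (asm) sum.union_disjoint)
       (auto simp: finite_Delta, auto simp: Delta_compl_def finite_Delta)
qed

lemma monom_pair_le:
  assumes "\<And>i. i \<in> set is \<union> set js \<Longrightarrow> 0 \<le> x $ i \<and> x $ i \<le> c \<and> 0 \<le> y $ i \<and> y $ i \<le> c"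
  shows "real_monom x is * real_monom y js \<le> c ^ (length is + length js)"
proof -
  have "0 \<le> real_monom x is \<and> real_monom x is \<le> real_monom (\<chi> i. c) is"
    "0 \<le> real_monom y js \<and> real_monom y js \<le> real_monom (\<chi> i. c) js"
    by (rule real_monom_mono; use assms in force)+
  thus ?thesis by (simp add: real_monom_const power_add mult_mono)
qed

lemma monom_pair_ge:
  assumes "c \<ge> 0" "\<And>i. i \<in> set is \<union> set js \<Longrightarrow> c \<le> x $ i \<and> c \<le> y $ i"
  shows "c ^ (length is + length js) \<le> real_monom x is * real_monom y js"
proof -
  have "0 \<le> real_monom (\<chi> i. c) is \<and> real_monom (\<chi> i. c) is \<le> real_monom x is"
    "0 \<le> real_monom (\<chi> i. c) js \<and> real_monom (\<chi> i. c) js \<le> real_monom y js"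
    by (rule real_monom_mono; use assms in force)+
  moreover from this have "0 \<le> real_monom x is" by linarith
  ultimately have "real_monom (\<chi> i. c) is * real_monom (\<chi> i. c) js \<le> real_monom x is * real_monom y js"
    by (intro mult_mono) auto
  thus ?thesis by (simp add: power_add real_monom_const)
qed

text \<open>
  A monomial all of whose indices lie in \<open>T\<close> is at most \<open>a^(p + q - 1)\<close>; any other one is still at most
  \<open>b^(p + q - 1)\<close>.
\<close>
lemma row_form_upper:
  assumes "nonneg_rtensor p q A" "p \<ge> 1"
    and xy: "\<And>i. 0 \<le> x $ i \<and> x $ i \<le> b \<and> 0 \<le> y $ i \<and> y $ i \<le> b"
    and T: "\<And>i. i \<in> T \<Longrightarrow> x $ i \<le> a \<and> y $ i \<le> a"
  shows "row_form p q A x y i \<le> row_part A (Delta p q T) i * a ^ (p + q - 1) +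
           row_part A (Delta_compl p q T) i * b ^ (p + q - 1)"
proof -
  have len: "length is + length js = p + q - 1" if "(is, js) \<in> Delta p q UNIV" for "is" js :: "'a list"
    using that assms(2) by (auto simp: Delta_def tuples_def)
  have D: "Delta p q T \<subseteq> Delta p q UNIV" "Delta_compl p q T \<subseteq> Delta p q UNIV"
    by (auto simp: Delta_def Delta_compl_def tuples_def)
  have "real_monom x is * real_monom y js \<le> a ^ (p + q - 1)" if "(is, js) \<in> Delta p q T" for "is" js
  proof -
    have "set is \<union> set js \<subseteq> T" using that by (auto simp: Delta_def tuples_def)
    hence "real_monom x is * real_monom y js \<le> a ^ (length is + length js)"
      using T xy by (intro monom_pair_le) blast
    thus ?thesis using len[of "is" js] that D by auto
  qed
  moreover have "real_monom x is * real_monom y js \<le> b ^ (p + q - 1)"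
    if "(is, js) \<in> Delta_compl p q T" for "is" js
    using monom_pair_le[of "is" js x b y] xy that len[of "is" js] D by auto
  ultimately show ?thesis
    unfolding row_form_split[OF assms(1,2), where T = T] row_part_def sum_distrib_right
    by (intro add_mono sum_mono) (auto intro!: mult_left_mono)
qed

lemma row_form_lower:
  assumes "nonneg_rtensor p q A" "p \<ge> 1" and b: "0 \<le> b" and a: "0 \<le> a"
    and xy: "\<And>i. b \<le> x $ i \<and> b \<le> y $ i"
    and T: "\<And>i. i \<in> T \<Longrightarrow> a \<le> x $ i \<and> a \<le> y $ i"
  shows "row_part A (Delta p q T) i * a ^ (p + q - 1) +
           row_part A (Delta_compl p q T) i * b ^ (p + q - 1) \<le> row_form p q A x y i"
proof -
  have len: "length is + length js = p + q - 1" if "(is, js) \<in> Delta p q UNIV" for "is" js :: "'a list"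
    using that assms(2) by (auto simp: Delta_def tuples_def)
  have D: "Delta p q T \<subseteq> Delta p q UNIV" "Delta_compl p q T \<subseteq> Delta p q UNIV"
    by (auto simp: Delta_def Delta_compl_def tuples_def)
  have "a ^ (p + q - 1) \<le> real_monom x is * real_monom y js" if "(is, js) \<in> Delta p q T" for "is" js
  proof -
    have "set is \<union> set js \<subseteq> T" using that by (auto simp: Delta_def tuples_def)
    hence "a ^ (length is + length js) \<le> real_monom x is * real_monom y js"
      using T a by (intro monom_pair_ge) blast+
    thus ?thesis using len[of "is" js] that D by auto
  qed
  moreover have "b ^ (p + q - 1) \<le> real_monom x is * real_monom y js"
    if "(is, js) \<in> Delta_compl p q T" for "is" js
    using monom_pair_ge[of b "is" js x y] xy b that len[of "is" js] D by auto
  ultimately show ?thesis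
    unfolding row_form_split[OF assms(1,2), where T = T] row_part_def sum_distrib_right
    by (intro add_mono sum_mono) (auto intro!: mult_left_mono)
qed

section \<open>Subsolutions, supersolutions and the bounds\<close>

text \<open>
  A sub-pair records what survives of the singular value equations when all entries are replaced by
  their moduli. Super-pairs are the positive solutions of the reverse inequalities; the numbers \<open>t\<close>
  with a super-pair are those of the Collatz-Wielandt formula for the Perron root.
\<close>
definition sub_pair :: "nat \<Rightarrow> nat \<Rightarrow> 'n::finite rtensor \<Rightarrow> real \<Rightarrow> real ^ 'n \<Rightarrow> real ^ 'n \<Rightarrow> bool" where
  "sub_pair p q A t x y \<longleftrightarrow> 0 \<le> t \<and> (\<forall>i. 0 \<le> x $ i \<and> 0 \<le> y $ i \<and>
     t * (x $ i) ^ (p + q - 1) \<le> row_form p q A x y i \<and>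
     t * (y $ i) ^ (p + q - 1) \<le> col_form p q A x y i)"

definition super_pair :: "nat \<Rightarrow> nat \<Rightarrow> 'n::finite rtensor \<Rightarrow> real \<Rightarrow> real ^ 'n \<Rightarrow> real ^ 'n \<Rightarrow> bool" where
  "super_pair p q A t x y \<longleftrightarrow> (\<forall>i. 0 < x $ i \<and> 0 < y $ i \<and>
     row_form p q A x y i \<le> t * (x $ i) ^ (p + q - 1) \<and>
     col_form p q A x y i \<le> t * (y $ i) ^ (p + q - 1))"

lemma sub_pair_flip: "sub_pair q p (flip_tensor A) t y x \<longleftrightarrow> sub_pair p q A t x y"
  by (auto simp: sub_pair_def add.commute)

lemma super_pair_flip: "super_pair q p (flip_tensor A) t y x \<longleftrightarrow> super_pair p q A t x y"
  by (auto simp: super_pair_def add.commute)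

text \<open>
  Multiplying the first inequality by \<open>t\<close> and inserting the second one eliminates \<open>a\<close>; division by \<open>b\<close>
  leaves \<open>(t - r) t \<le> s m\<close>, whose nonnegative solutions lie below the larger root.
\<close>
lemma two_level_upper:
  fixes t a b r s m :: real
  assumes "0 \<le> a" "0 < b" "0 \<le> r" "0 \<le> s" "0 \<le> m" "0 \<le> t"
    and 1: "t * b \<le> s * a + r * b" and 2: "t * a \<le> m * b"
  shows "t \<le> half_root r s m"
proof -
  have "(t - r) * t * b \<le> t * (s * a)"
    using mult_left_mono[OF 1, of t] assms by (simp add: algebra_simps)
  also have "\<dots> \<le> s * (m * b)"
    using mult_left_mono[OF 2, of s] assms by (simp add: algebra_simps)
  finally have "(t - r) * t \<le> s * m"
    using assms by (metis mult.assoc mult_le_cancel_right_pos)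
  thus ?thesis using assms
    by (intro le_half_root) (auto simp: power2_eq_square algebra_simps)
qed

text \<open>
  The first inequality gives \<open>r \<le> t\<close>, so that it may be multiplied by \<open>t\<close> as in the dual statement;
  \<open>t \<ge> r\<close> also rules out that \<open>t\<close> lies below the smaller root.
\<close>
lemma two_level_lower:
  fixes t a b r s m :: real
  assumes "0 \<le> a" "0 < b" "0 \<le> r" "0 \<le> s" "0 \<le> m"
    and 1: "s * a + r * b \<le> t * b" and 2: "m * b \<le> t * a"
  shows "half_root r s m \<le> t"
proof -
  have "r * b \<le> t * b" using 1 assms by (smt (verit) mult_nonneg_nonneg)
  hence tr: "r \<le> t" using assms by simp
  have "s * (m * b) \<le> s * (t * a)"
    using mult_left_mono[OF 2, of s] assms by simp
  also have "\<dots> \<le> (t - r) * t * b"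
    using mult_left_mono[OF 1, of t] assms tr by (simp add: algebra_simps)
  finally have "s * m \<le> (t - r) * t"
    using assms by (metis mult.assoc mult_le_cancel_right_pos)
  thus ?thesis using assms tr
    by (intro half_root_le) (auto simp: power2_eq_square algebra_simps)
qed

lemma Phi_hat_ge:
  assumes "i \<in> T" "j \<notin> T"
  shows "half_root (row_part A (Delta_compl p q T) j) (row_part A (Delta p q T) j) (max_sum p q A i)
    \<le> Phi_hat p q A T"
  unfolding Phi_hat_def using assms
  by (intro Max_ge) (auto intro!: image_eqI[of _ _ "(i, j)"])

lemma Theta_hat_le:
  assumes "i \<in> T" "j \<notin> T"
  shows "Theta_hat p q A T \<le>
    half_root (row_part A (Delta_compl p q T) j) (row_part A (Delta p q T) j) (min_sum p q A i)"
  unfolding Theta_hat_def using assms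
  by (intro Min_le) (auto intro!: image_eqI[of _ _ "(i, j)"])

lemma sub_pair_le_max_sum:
  assumes "nonneg_rtensor p q A" "p \<ge> 1" "q \<ge> 1" and sp: "sub_pair p q A t x y"
    and b: "\<And>k. x $ k \<le> b \<and> y $ k \<le> b"
  shows "t * (max (x $ i) (y $ i)) ^ (p + q - 1) \<le> max_sum p q A i * b ^ (p + q - 1)"
proof -
  have b0: "0 \<le> b" using sp b[of i] unfolding sub_pair_def by (meson order_trans)
  have nn: "0 \<le> x $ k" "0 \<le> y $ k" for k using sp by (auto simp: sub_pair_def)
  have A': "nonneg_rtensor q p (flip_tensor A)" using assms by (simp add: nonneg_flip)
  have "t * (x $ i) ^ (p + q - 1) \<le> row_sum p q A i * b ^ (p + q - 1)"
    using row_form_mono[OF assms(1,2), of x "\<chi> k. b" y "\<chi> k. b" i] sp b nn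
    by (auto simp: row_form_const[OF assms(1,2)] sub_pair_def intro: order_trans)
  also have "\<dots> \<le> max_sum p q A i * b ^ (p + q - 1)"
    using b0 by (intro mult_right_mono) (auto simp: max_sum_def)
  finally have 1: "t * (x $ i) ^ (p + q - 1) \<le> max_sum p q A i * b ^ (p + q - 1)" .
  have "t * (y $ i) ^ (p + q - 1) \<le> col_sum p q A i * b ^ (p + q - 1)"
    using row_form_mono[OF A' assms(3), of y "\<chi> k. b" x "\<chi> k. b" i] sp b nn
    by (auto simp: row_form_const[OF A' assms(3)] sub_pair_def flip_col_sum add.commute intro: order_trans)
  also have "\<dots> \<le> max_sum p q A i * b ^ (p + q - 1)"
    using b0 by (intro mult_right_mono) (auto simp: max_sum_def)
  finally show ?thesis using 1 by (simp add: max_def)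
qed

lemma super_pair_ge_min_sum:
  assumes "nonneg_rtensor p q A" "p \<ge> 1" "q \<ge> 1" and sp: "super_pair p q A t x y"
    and b0: "0 \<le> b" and b: "\<And>k. b \<le> x $ k \<and> b \<le> y $ k"
  shows "min_sum p q A i * b ^ (p + q - 1) \<le> t * (min (x $ i) (y $ i)) ^ (p + q - 1)"
proof -
  have A': "nonneg_rtensor q p (flip_tensor A)" using assms by (simp add: nonneg_flip)
  have "min_sum p q A i * b ^ (p + q - 1) \<le> row_sum p q A i * b ^ (p + q - 1)"
    using b0 by (intro mult_right_mono) (auto simp: min_sum_def)
  also have "\<dots> \<le> t * (x $ i) ^ (p + q - 1)"
    using row_form_mono[OF assms(1,2), of "\<chi> k. b" x "\<chi> k. b" y i] sp b b0
    by (auto simp: row_form_const[OF assms(1,2)] super_pair_def intro: order_trans)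
  finally have 1: "min_sum p q A i * b ^ (p + q - 1) \<le> t * (x $ i) ^ (p + q - 1)" .
  have "min_sum p q A i * b ^ (p + q - 1) \<le> col_sum p q A i * b ^ (p + q - 1)"
    using b0 by (intro mult_right_mono) (auto simp: min_sum_def)
  also have "\<dots> \<le> t * (y $ i) ^ (p + q - 1)"
    using row_form_mono[OF A' assms(3), of "\<chi> k. b" y "\<chi> k. b" x i] sp b b0
    by (auto simp: row_form_const[OF A' assms(3)] super_pair_def flip_col_sum add.commute intro: order_trans)
  finally show ?thesis using 1 by (simp add: min_def)
qed

text \<open>
  Here the overall maximum of both vectors is an entry of \<open>x\<close> outside \<open>S\<close>, and \<open>i\<close> maximises
  \<open>max (x $ i) (y $ i)\<close> over \<open>S\<close>; the row inequality at \<open>j\<close> and the row or column inequality at \<open>i\<close> are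
  the two inequalities to eliminate from.
\<close>
lemma sub_pair_le_Phi_hat:
  assumes A: "nonneg_rtensor p q A" "p \<ge> 1" "q \<ge> 1" and sp: "sub_pair p q A t x y"
    and j: "j \<notin> S" "x $ j > 0" and b: "\<And>k. x $ k \<le> x $ j \<and> y $ k \<le> x $ j" and S: "S \<noteq> {}"
  shows "t \<le> Phi_hat p q A S"
proof -
  obtain i where i: "i \<in> S" and i_max: "\<And>k. k \<in> S \<Longrightarrow> max (x $ k) (y $ k) \<le> max (x $ i) (y $ i)"
  proof -
    let ?M = "Max ((\<lambda>k. max (x $ k) (y $ k)) ` S)"
    have "?M \<in> (\<lambda>k. max (x $ k) (y $ k)) ` S" using S by (intro Max_in) auto
    then obtain i where "i \<in> S" "?M = max (x $ i) (y $ i)" by blast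
    moreover have "max (x $ k) (y $ k) \<le> ?M" if "k \<in> S" for k
      using that by (intro Max_ge) auto
    ultimately show ?thesis using that by metis
  qed
  define a where "a = max (x $ i) (y $ i)"
  have nn: "0 \<le> x $ k" "0 \<le> y $ k" for k using sp by (auto simp: sub_pair_def)
  have "t * (x $ j) ^ (p + q - 1) \<le> row_form p q A x y j" using sp by (simp add: sub_pair_def)
  also have "\<dots> \<le> row_part A (Delta p q S) j * a ^ (p + q - 1) +
           row_part A (Delta_compl p q S) j * (x $ j) ^ (p + q - 1)"
    using b nn i_max by (intro row_form_upper[OF A(1,2)]) (auto simp: a_def)
  finally have 1: "t * (x $ j) ^ (p + q - 1) \<le> row_part A (Delta p q S) j * a ^ (p + q - 1) +
           row_part A (Delta_compl p q S) j * (x $ j) ^ (p + q - 1)" .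
  have 2: "t * a ^ (p + q - 1) \<le> max_sum p q A i * (x $ j) ^ (p + q - 1)"
    unfolding a_def using b by (intro sub_pair_le_max_sum[OF A sp]) auto
  have "t \<le> half_root (row_part A (Delta_compl p q S) j) (row_part A (Delta p q S) j) (max_sum p q A i)"
    using j sp nn[of i] row_sum_nonneg[of p q A i] max_sum_ge[of p q A i]
    by (intro two_level_upper[OF _ _ _ _ _ _ 1 2]) (auto simp: row_part_nonneg sub_pair_def a_def le_max_iff_disj intro!: zero_le_power)
  also have "\<dots> \<le> Phi_hat p q A S" using i j by (intro Phi_hat_ge)
  finally show ?thesis .
qed

lemma super_pair_ge_Theta_hat:
  assumes A: "nonneg_rtensor p q A" "p \<ge> 1" "q \<ge> 1" and sp: "super_pair p q A t x y"
    and j: "j \<notin> S" and b: "\<And>k. x $ j \<le> x $ k \<and> x $ j \<le> y $ k" and S: "S \<noteq> {}"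
  shows "Theta_hat p q A S \<le> t"
proof -
  obtain i where i: "i \<in> S" and i_min: "\<And>k. k \<in> S \<Longrightarrow> min (x $ i) (y $ i) \<le> min (x $ k) (y $ k)"
  proof -
    let ?M = "Min ((\<lambda>k. min (x $ k) (y $ k)) ` S)"
    have "?M \<in> (\<lambda>k. min (x $ k) (y $ k)) ` S" using S by (intro Min_in) auto
    then obtain i where "i \<in> S" "?M = min (x $ i) (y $ i)" by blast
    moreover have "?M \<le> min (x $ k) (y $ k)" if "k \<in> S" for k
      using that by (intro Min_le) auto
    ultimately show ?thesis using that by metis
  qed
  define a where "a = min (x $ i) (y $ i)"
  have pos: "0 < x $ k" "0 < y $ k" for k using sp by (auto simp: super_pair_def)
  have a: "0 \<le> a" using pos[of i] by (simp add: a_def)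
  have "row_part A (Delta p q S) j * a ^ (p + q - 1) +
           row_part A (Delta_compl p q S) j * (x $ j) ^ (p + q - 1) \<le> row_form p q A x y j"
    using b pos[of j] a i_min by (intro row_form_lower[OF A(1,2)]) (auto simp: a_def)
  also have "\<dots> \<le> t * (x $ j) ^ (p + q - 1)" using sp by (simp add: super_pair_def)
  finally have 1: "row_part A (Delta p q S) j * a ^ (p + q - 1) +
           row_part A (Delta_compl p q S) j * (x $ j) ^ (p + q - 1) \<le> t * (x $ j) ^ (p + q - 1)" .
  have 2: "min_sum p q A i * (x $ j) ^ (p + q - 1) \<le> t * a ^ (p + q - 1)"
    unfolding a_def using b pos[of j] by (intro super_pair_ge_min_sum[OF A sp]) auto
  have "Theta_hat p q A S \<le>
      half_root (row_part A (Delta_compl p q S) j) (row_part A (Delta p q S) j) (min_sum p q A i)"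
    using i j by (intro Theta_hat_le)
  also have "\<dots> \<le> t"
    using j a pos min_sum_nonneg[of p q A i]
    by (intro two_level_lower[OF _ _ _ _ _ 1 2]) (auto simp: row_part_nonneg)
  finally show ?thesis .
qed

lemma sub_pair_le_Phi_bound_row:
  assumes A: "nonneg_rtensor p q A" "p \<ge> 1" "q \<ge> 1" and sp: "sub_pair p q A t x y"
    and j: "x $ j > 0" and b: "\<And>k. x $ k \<le> x $ j \<and> y $ k \<le> x $ j" and S: "S \<noteq> {}" "S \<noteq> UNIV"
  shows "t \<le> Phi_bound p q A S"
proof (cases "j \<in> S")
  case False
  have "t \<le> Phi_hat p q A S" using sub_pair_le_Phi_hat[OF A sp False j b S(1)] .
  thus ?thesis by (simp add: Phi_bound_def)
next
  case True
  have "t \<le> Phi_hat p q A (- S)" using sub_pair_le_Phi_hat[OF A sp _ j b, of "- S"] S True by auto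
  thus ?thesis by (simp add: Phi_bound_def)
qed

lemma super_pair_ge_Theta_bound_row:
  assumes A: "nonneg_rtensor p q A" "p \<ge> 1" "q \<ge> 1" and sp: "super_pair p q A t x y"
    and b: "\<And>k. x $ j \<le> x $ k \<and> x $ j \<le> y $ k" and S: "S \<noteq> {}" "S \<noteq> UNIV"
  shows "Theta_bound p q A S \<le> t"
proof (cases "j \<in> S")
  case False
  have "Theta_hat p q A S \<le> t" using super_pair_ge_Theta_hat[OF A sp False b S(1)] .
  thus ?thesis by (simp add: Theta_bound_def)
next
  case True
  have "Theta_hat p q A (- S) \<le> t" using super_pair_ge_Theta_hat[OF A sp _ b, of "- S"] S True by auto
  thus ?thesis by (simp add: Theta_bound_def)
qed

lemma super_pair_ge_Theta_bound:
  assumes A: "nonneg_rtensor p q A" "p \<ge> 1" "q \<ge> 1" and sp: "super_pair p q A t x y"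
    and S: "S \<noteq> {}" "S \<noteq> UNIV"
  shows "Theta_bound p q A S \<le> t"
proof -
  let ?W = "range (($) x) \<union> range (($) y)"
  have le: "Min ?W \<le> x $ k" "Min ?W \<le> y $ k" for k by (intro Min_le; simp)+
  have "Min ?W \<in> ?W" by (intro Min_in) auto
  then consider j where "Min ?W = x $ j" | j where "Min ?W = y $ j" by blast
  thus ?thesis
  proof cases
    case (1 j)
    thus ?thesis using super_pair_ge_Theta_bound_row[OF A sp _ S, of j] le by metis
  next
    case (2 j)
    have "super_pair q p (flip_tensor A) t y x" using sp by (simp add: super_pair_flip)
    from super_pair_ge_Theta_bound_row[OF _ A(3,2) this _ S, of j] 2 le A show ?thesis
      unfolding Theta_bound_flip nonneg_flip by metis
  qed
qed

text \<open>
  If the overall maximum is an entry of \<open>y\<close>, flipping the tensor moves it to the first vector.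
\<close>
lemma sub_pair_le_Phi_bound:
  assumes A: "nonneg_rtensor p q A" "p \<ge> 1" "q \<ge> 1" and sp: "sub_pair p q A t x y"
    and nz: "x \<noteq> 0" and S: "S \<noteq> {}" "S \<noteq> UNIV"
  shows "t \<le> Phi_bound p q A S"
proof -
  let ?W = "range (($) x) \<union> range (($) y)"
  have le: "x $ k \<le> Max ?W" "y $ k \<le> Max ?W" for k by (intro Max_ge; simp)+
  obtain i where "x $ i \<noteq> 0" using nz by (auto simp: vec_eq_iff)
  hence "x $ i > 0" using sp by (auto simp: sub_pair_def order_less_le)
  hence pos: "Max ?W > 0" using le(1)[of i] by (rule less_le_trans)
  have "Max ?W \<in> ?W" by (intro Max_in) auto
  then consider j where "Max ?W = x $ j" | j where "Max ?W = y $ j" by blast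
  thus ?thesis
  proof cases
    case (1 j)
    thus ?thesis using sub_pair_le_Phi_bound_row[OF A sp _ _ S, of j] le pos by metis
  next
    case (2 j)
    have "sub_pair q p (flip_tensor A) t y x" using sp by (simp add: sub_pair_flip)
    from sub_pair_le_Phi_bound_row[OF _ A(3,2) this _ _ S, of j] 2 le A pos show ?thesis
      unfolding Phi_bound_flip nonneg_flip by metis
  qed
qed

text \<open>
  Where the scaled supersolution touches the subsolution from above, monotonicity and homogeneity of
  the form compare the two factors.
\<close>
lemma sub_pair_le_super_pair_row:
  assumes A: "nonneg_rtensor p q A" "p \<ge> 1"
    and sub: "sub_pair p q A s u v" and super: "super_pair p q A t x y"
    and c: "c > 0" "\<And>k. u $ k \<le> c * x $ k \<and> v $ k \<le> c * y $ k" and i: "u $ i = c * x $ i"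
  shows "s \<le> t"
proof -
  have pos: "x $ i > 0" using super by (simp add: super_pair_def)
  have "s * (u $ i) ^ (p + q - 1) \<le> row_form p q A u v i" using sub by (simp add: sub_pair_def)
  also have "\<dots> \<le> row_form p q A (c *\<^sub>R x) (c *\<^sub>R y) i"
    using sub c by (intro row_form_mono[OF A]) (auto simp: sub_pair_def)
  also have "\<dots> = c ^ (p + q - 1) * row_form p q A x y i"
    using A(2) by (simp add: row_form_scale power_add[symmetric])
  also have "\<dots> \<le> c ^ (p + q - 1) * (t * (x $ i) ^ (p + q - 1))"
    using super c by (intro mult_left_mono) (auto simp: super_pair_def)
  also have "\<dots> = t * (u $ i) ^ (p + q - 1)" unfolding i by (simp add: power_mult_distrib)
  finally show ?thesis
    using mult_le_cancel_right_pos[of "(u $ i) ^ (p + q - 1)" s t] c pos i by simp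
qed

text \<open>
  The least \<open>c\<close> with \<open>(u, v) \<le> c (x, y)\<close> is a maximum of finitely many quotients, so that the two pairs
  touch at some entry.
\<close>
lemma sub_pair_le_super_pair:
  assumes A: "nonneg_rtensor p q A" "p \<ge> 1" "q \<ge> 1"
    and sub: "sub_pair p q A s u v" and super: "super_pair p q A t x y" and nz: "u \<noteq> 0"
  shows "s \<le> t"
proof -
  let ?W = "range (\<lambda>k. u $ k / x $ k) \<union> range (\<lambda>k. v $ k / y $ k)"
  define c where "c = Max ?W"
  have pos: "x $ k > 0" "y $ k > 0" for k using super by (auto simp: super_pair_def)
  have le: "u $ k / x $ k \<le> c" "v $ k / y $ k \<le> c" for k unfolding c_def by (intro Max_ge; simp)+
  have le': "u $ k \<le> c * x $ k \<and> v $ k \<le> c * y $ k" for k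
    using le[of k] pos[of k] by (simp add: pos_divide_le_eq)
  obtain i where "u $ i \<noteq> 0" using nz by (auto simp: vec_eq_iff)
  hence "u $ i > 0" using sub by (auto simp: sub_pair_def order_less_le)
  hence "u $ i / x $ i > 0" using pos by simp
  hence c: "c > 0" using le(1)[of i] by linarith
  have "c \<in> ?W" unfolding c_def by (intro Max_in) auto
  then consider j where "c = u $ j / x $ j" | j where "c = v $ j / y $ j" by blast
  thus ?thesis
  proof cases
    case (1 j)
    hence "u $ j = c * x $ j" using pos[of j] by simp
    thus ?thesis using sub_pair_le_super_pair_row[OF A(1,2) sub super c le'] by blast
  next
    case (2 j)
    hence *: "v $ j = c * y $ j" using pos[of j] by simp
    have "sub_pair q p (flip_tensor A) s v u" using sub by (simp add: sub_pair_flip)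
    moreover have "super_pair q p (flip_tensor A) t y x" using super by (simp add: super_pair_flip)
    ultimately show ?thesis using sub_pair_le_super_pair_row[of q p "flip_tensor A" s v u t y x c j] * c le' A
      unfolding nonneg_flip by blast
  qed
qed

section \<open>Singular values and real pairs\<close>

lemma contract_row_alt:
  "contract_row p q A x y $ i =
    (\<Sum>(is, js)\<in>Delta p q UNIV. of_real (A (i # is) js) * (monom_at x is * monom_at y js))"
  unfolding contract_row_def Delta_def by (simp add: sum.cartesian_product mult.assoc)

lemma contract_col_flip: "contract_col p q A x y = contract_row q p (flip_tensor A) y x"
  unfolding contract_row_def contract_col_def flip_tensor_def
  by (subst sum.swap) (simp add: mult.assoc mult.commute[of "monom_at x _"])

lemma norm_contract_row:
  assumes "nonneg_rtensor p q A" "p \<ge> 1"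
  shows "cmod (contract_row p q A x y $ i) \<le> row_form p q A (\<chi> i. cmod (x $ i)) (\<chi> i. cmod (y $ i)) i"
  unfolding contract_row_alt row_form_def
  by (rule sum_norm_le) (auto simp: norm_mult norm_monom_at nonneg_rtensor_Cons[OF assms])

lemma contract_row_of_real:
  "contract_row p q A (\<chi> i. of_real (x $ i)) (\<chi> i. of_real (y $ i)) $ i = of_real (row_form p q A x y i)"
  unfolding contract_row_alt row_form_def by (simp add: monom_at_of_real case_prod_unfold)

lemma singular_value_sub_pair:
  assumes A: "nonneg_rtensor p q A" "p \<ge> 1" "q \<ge> 1" and "singular_value p q A \<mu>"
  obtains u v where "sub_pair p q A (cmod \<mu>) u v" "u \<noteq> 0"
proof -
  from assms obtain x y where xy: "x \<noteq> 0" "contract_row p q A x y = \<mu> *s vec_power x (p + q - 1)"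
    "contract_row q p (flip_tensor A) y x = \<mu> *s vec_power y (p + q - 1)"
    unfolding singular_value_def contract_col_flip by blast
  have A': "nonneg_rtensor q p (flip_tensor A)" using A by (simp add: nonneg_flip)
  have "sub_pair p q A (cmod \<mu>) (\<chi> i. cmod (x $ i)) (\<chi> i. cmod (y $ i))"
    unfolding sub_pair_def
    using norm_contract_row[OF A(1,2), of x y] norm_contract_row[OF A' A(3), of y x]
    by (simp add: xy vec_power_def norm_mult norm_power)
  moreover have "(\<chi> i. cmod (x $ i)) \<noteq> 0" using xy(1) by (auto simp: vec_eq_iff)
  ultimately show ?thesis by (rule that)
qed

lemma singular_value_of_real:
  assumes "x \<noteq> 0" "y \<noteq> 0"
    "\<And>i. row_form p q A x y i = t * (x $ i) ^ (p + q - 1)"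
    "\<And>i. col_form p q A x y i = t * (y $ i) ^ (p + q - 1)"
  shows "singular_value p q A (of_real t)"
  unfolding singular_value_def contract_col_flip
proof (intro exI conjI)
  show "(\<chi> i. complex_of_real (x $ i)) \<noteq> 0" "(\<chi> i. complex_of_real (y $ i)) \<noteq> 0"
    using assms(1,2) by (auto simp: vec_eq_iff)
qed (simp_all add: vec_eq_iff contract_row_of_real assms vec_power_def)

section \<open>Euler's identity and continuity of the forms\<close>

lemma sum_tuples_Suc:
  "(\<Sum>is\<in>tuples (Suc k) (UNIV :: 'n::finite set). f is) = (\<Sum>i\<in>UNIV. \<Sum>is\<in>tuples k UNIV. f (i # is))"
proof -
  have "tuples (Suc k) (UNIV :: 'n set) = (\<lambda>(i, is). i # is) ` (UNIV \<times> tuples k UNIV)"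
    by (auto simp: tuples_def length_Suc_conv image_iff)
  moreover have "inj_on (\<lambda>(i, is). i # is) (UNIV \<times> tuples k (UNIV :: 'n set))"
    by (auto simp: inj_on_def)
  ultimately show ?thesis
    by (simp add: sum.reindex sum.cartesian_product case_prod_unfold)
qed

lemma euler_row:
  assumes "p \<ge> 1"
  shows "(\<Sum>i\<in>UNIV. x $ i * row_form p q A x y i) =
    (\<Sum>is\<in>tuples p UNIV. \<Sum>js\<in>tuples q UNIV. A is js * (real_monom x is * real_monom y js))"
proof -
  obtain k where p: "p = Suc k" using assms by (cases p) auto
  show ?thesis
    unfolding p sum_tuples_Suc row_form_def Delta_def sum_distrib_left
    by (simp add: sum.cartesian_product sum_distrib_left case_prod_unfold mult_ac)
qed

lemma row_form_nonneg:
  assumes "nonneg_rtensor p q A" "p \<ge> 1" and x: "\<And>i. 0 \<le> x $ i" and y: "\<And>i. 0 \<le> y $ i"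
  shows "0 \<le> row_form p q A x y i"
  unfolding row_form_def
  by (intro sum_nonneg)
     (auto intro!: mult_nonneg_nonneg real_monom_nonneg x y nonneg_rtensor_Cons[OF assms(1,2)])

text \<open>
  Both sides are the full contraction \<open>A x^p y^q\<close>. On a solution of the two
  equations with factors \<open>a\<close> and \<open>b\<close> they become \<open>a\<close> and \<open>b\<close> times the \<open>(p + q)\<close>-th power sums of \<open>x\<close> and
  \<open>y\<close>, so that \<open>a = b\<close> once these sums agree.
\<close>
lemma euler_identity:
  assumes "p \<ge> 1" "q \<ge> 1"
  shows "(\<Sum>i\<in>UNIV. x $ i * row_form p q A x y i) = (\<Sum>j\<in>UNIV. y $ j * col_form p q A x y j)"
  unfolding euler_row[OF assms(1)] euler_row[OF assms(2)]
  by (subst sum.swap) (simp add: flip_tensor_def mult_ac)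

lemma tendsto_real_monom:
  assumes "(f \<longlongrightarrow> x) F"
  shows "((\<lambda>z. real_monom (f z) is) \<longlongrightarrow> real_monom x is) F"
  by (induction "is") (auto intro!: tendsto_intros assms)

text \<open>
  The tensor varies along with the vectors, because the limit of perturbed tensors is taken below.
\<close>
lemma tendsto_row_form:
  assumes "(f \<longlongrightarrow> x) F" "(g \<longlongrightarrow> y) F" "\<And>is js. ((\<lambda>z. B z is js) \<longlongrightarrow> A is js) F"
  shows "((\<lambda>z. row_form p q (B z) (f z) (g z) i) \<longlongrightarrow> row_form p q A x y i) F"
  unfolding row_form_def case_prod_unfold
  by (intro tendsto_sum tendsto_mult tendsto_real_monom assms)

lemma continuous_on_row_form:
  assumes "continuous_on S f" "continuous_on S g"
  shows "continuous_on S (\<lambda>z. row_form p q A (f z) (g z) i)"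
  using assms unfolding continuous_on_def by (auto intro!: tendsto_row_form)

lemma row_form_pos:
  assumes A: "\<forall>is\<in>tuples p UNIV. \<forall>js\<in>tuples q UNIV. A is js > 0" and "p \<ge> 1"
    and x: "\<And>k. x $ k \<ge> 0" "x $ i > 0" and y: "\<And>k. y $ k \<ge> 0" "y $ j > 0"
  shows "row_form p q A x y k > 0"
proof -
  have A': "A (k # is) js > 0" if "(is, js) \<in> Delta p q UNIV" for "is" js
    using that assms(2) A by (auto simp: Delta_def tuples_def)
  have "(replicate (p - 1) i, replicate q j) \<in> Delta p q UNIV"
    by (auto simp: Delta_def tuples_def)
  thus ?thesis unfolding row_form_def
    by (intro sum_pos2[where i = "(replicate (p - 1) i, replicate q j)"])
       (auto simp: finite_Delta x y real_monom_nonneg intro!: mult_pos_pos A' real_monom_pos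
             mult_nonneg_nonneg less_imp_le[OF A'])
qed

section \<open>Eigenpairs of positive tensors\<close>

definition prob_simplex :: "(real ^ 'n) set" where
  "prob_simplex = {x. (\<forall>i. 0 \<le> x $ i) \<and> (\<Sum>i\<in>UNIV. x $ i) = 1}"

lemma compact_prob_simplex: "compact (prob_simplex :: (real ^ 'n) set)"
proof -
  have "closed (prob_simplex :: (real ^ 'n) set)"
    unfolding prob_simplex_def
    by (intro closed_Collect_conj closed_Collect_all closed_Collect_le closed_Collect_eq
        continuous_intros)
  moreover have le: "0 \<le> x $ i" "x $ i \<le> 1" if "x \<in> prob_simplex" for x :: "real ^ 'n" and i
    using that member_le_sum[of i UNIV "($) x"] by (auto simp: prob_simplex_def)
  hence "prob_simplex \<subseteq> cbox 0 ((\<chi> i. 1) :: real ^ 'n)"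
    by (auto simp: mem_box_cart le)
  hence "bounded (prob_simplex :: (real ^ 'n) set)" using bounded_cbox bounded_subset by blast
  ultimately show ?thesis by (simp add: compact_eq_bounded_closed)
qed

lemma convex_prob_simplex: "convex (prob_simplex :: (real ^ 'n) set)"
  unfolding convex_def prob_simplex_def
  by (auto simp: sum.distrib sum_distrib_left[symmetric])

lemma prob_simplex_pos:
  assumes "x \<in> prob_simplex"
  obtains i where "x $ i > 0"
proof -
  have "x \<noteq> 0" using assms by (auto simp: prob_simplex_def)
  hence "\<exists>i. x $ i \<noteq> 0" by (simp add: vec_eq_iff)
  thus ?thesis using assms that by (auto simp: prob_simplex_def order_less_le)
qed

definition to_simplex :: "real ^ 'n \<Rightarrow> real ^ 'n" where
  "to_simplex v = (1 / (\<Sum>i\<in>UNIV. v $ i)) *\<^sub>R v"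

lemma to_simplex_mem:
  fixes v :: "real ^ 'n"
  assumes "\<And>i. v $ i > 0"
  shows "to_simplex v \<in> prob_simplex"
proof -
  have "(\<Sum>i\<in>UNIV. v $ i) > 0" using assms by (intro sum_pos) auto
  thus ?thesis using assms
    by (auto simp: prob_simplex_def to_simplex_def sum_divide_distrib[symmetric] less_imp_le)
qed

lemma continuous_on_to_simplex:
  fixes f :: "'a::topological_space \<Rightarrow> real ^ 'n"
  assumes "continuous_on S f" "\<And>z i. z \<in> S \<Longrightarrow> f z $ i > 0"
  shows "continuous_on S (\<lambda>z. to_simplex (f z))"
proof -
  have "(\<Sum>i\<in>UNIV. f z $ i) > 0" if "z \<in> S" for z using that assms by (intro sum_pos) auto
  thus ?thesis unfolding to_simplex_def
    by (intro continuous_intros assms) force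
qed

text \<open>
  A positive tensor maps a product of two simplices to positive vectors, so taking \<open>(p + q - 1)\<close>-th
  roots and normalising each component separately is a continuous self-map of a compact convex set. A
  fixed point solves both equations, with one factor for the rows and another one for the columns,
  since the two components are normalised independently. Normalising them together would
  not exclude that one of the components vanishes.
\<close>
lemma positive_tensor_two_eigenvalues:
  fixes A :: "'n::finite rtensor"
  assumes A: "\<forall>is\<in>tuples p UNIV. \<forall>js\<in>tuples q UNIV. A is js > 0"
    and pq: "p \<ge> 1" "q \<ge> 1"
  obtains a b x y where "\<And>i. x $ i > 0" "\<And>i. y $ i > 0"
    "\<And>i. row_form p q A x y i = a * (x $ i) ^ (p + q - 1)"
    "\<And>i. col_form p q A x y i = b * (y $ i) ^ (p + q - 1)"
proof -
  define k where "k = p + q - 1"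
  have k: "k > 0" using pq by (simp add: k_def)
  define K where "K = (prob_simplex :: (real ^ 'n) set) \<times> (prob_simplex :: (real ^ 'n) set)"
  define F where "F z = (\<chi> i. root k (row_form p q A (fst z) (snd z) i))" for z :: "(real ^ 'n) \<times> (real ^ 'n)"
  define G where "G z = (\<chi> i. root k (col_form p q A (fst z) (snd z) i))" for z :: "(real ^ 'n) \<times> (real ^ 'n)"
  have A': "\<forall>is\<in>tuples q UNIV. \<forall>js\<in>tuples p UNIV. flip_tensor A is js > 0"
    using A by (simp add: flip_tensor_def)
  have pos: "row_form p q A x y i > 0 \<and> col_form p q A x y i > 0" 
    if mem: "x \<in> prob_simplex" "y \<in> prob_simplex" for x y i
  proof -
    obtain j where "x $ j > 0" using mem(1) by (rule prob_simplex_pos)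
    moreover obtain l where "y $ l > 0" using mem(2) by (rule prob_simplex_pos)
    ultimately show ?thesis using mem row_form_pos[OF A pq(1), of x j y l i] row_form_pos[OF A' pq(2), of y l x j i]
      by (auto simp: prob_simplex_def)
  qed
  have F: "F z $ i > 0" and G: "G z $ i > 0" if "z \<in> K" for z i
    using that pos k by (auto simp: F_def G_def K_def)
  have cont: "continuous_on K F" "continuous_on K G"
    unfolding F_def G_def
    by (intro continuous_on_vec_lambda continuous_on_real_root continuous_on_row_form continuous_intros)+
  have contH: "continuous_on K (\<lambda>z. (to_simplex (F z), to_simplex (G z)))"
    by (intro continuous_on_Pair continuous_on_to_simplex cont F G)
  have mapH: "(\<lambda>z. (to_simplex (F z), to_simplex (G z))) \<in> K \<rightarrow> K"
    using F G unfolding K_def by (auto intro!: to_simplex_mem)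
  have K: "compact K" "convex K"
    unfolding K_def by (intro compact_Times convex_Times compact_prob_simplex convex_prob_simplex)+
  have ne: "K \<noteq> {}"
    using to_simplex_mem[of "\<chi> i. (1::real)"] by (auto simp: K_def)
  obtain z where z: "z \<in> K" "(to_simplex (F z), to_simplex (G z)) = z"
    by (rule brouwer[OF K ne contH mapH])
  define x y where "x = fst z" and "y = snd z"
  have xy: "to_simplex (F z) = x" "to_simplex (G z) = y" using z(2) by (auto simp: x_def y_def prod_eq_iff)
  define s t where "s = (\<Sum>i\<in>UNIV. F z $ i)" and "t = (\<Sum>i\<in>UNIV. G z $ i)"
  have st: "s > 0" "t > 0" unfolding s_def t_def by (auto intro!: sum_pos F G z(1))
  have eqs: "F z $ i = s * x $ i" "G z $ i = t * y $ i" for i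
    using st unfolding xy[symmetric] to_simplex_def s_def[symmetric] t_def[symmetric] by auto
  have "row_form p q A x y i = F z $ i ^ k" "col_form p q A x y i = G z $ i ^ k" for i
    using z(1) k pos[of x y i] unfolding F_def G_def x_def y_def K_def by auto
  hence "row_form p q A x y i = s ^ k * (x $ i) ^ k" "col_form p q A x y i = t ^ k * (y $ i) ^ k" for i
    by (auto simp: eqs power_mult_distrib)
  moreover have "x $ i > 0" "y $ i > 0" for i
    using F[OF z(1), of i] G[OF z(1), of i] st unfolding eqs by (auto simp: zero_less_mult_iff)
  ultimately show ?thesis using that unfolding k_def by blast
qed

lemma normalise_power_sum:
  fixes x :: "real ^ 'n"
  assumes "\<And>i. x $ i > 0" "l > 0"
  obtains c where "c > 0" "(\<Sum>i\<in>UNIV. (c * x $ i) ^ l) = 1"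
proof
  let ?s = "\<Sum>i\<in>UNIV. (x $ i) ^ l"
  have s: "?s > 0" using assms by (intro sum_pos) auto
  show "1 / root l ?s > 0" using s assms by simp
  show "(\<Sum>i\<in>UNIV. (1 / root l ?s * x $ i) ^ l) = 1"
    using s assms by (simp add: power_divide sum_divide_distrib[symmetric])
qed

text \<open>
  Rescaling both vectors to have \<open>(p + q)\<close>-th power sum \<open>1\<close> keeps the form of the equations, and then
  Euler's identity says that the two factors agree. This normalisation also keeps both vectors away from
  zero in a limit.
\<close>
lemma positive_tensor_eigenpair:
  fixes A :: "'n::finite rtensor"
  assumes A: "\<forall>is\<in>tuples p UNIV. \<forall>js\<in>tuples q UNIV. A is js > 0"
    and pq: "p \<ge> 1" "q \<ge> 1"
  obtains t x y where "\<And>i. x $ i > 0" "\<And>i. y $ i > 0"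
    "(\<Sum>i\<in>UNIV. (x $ i) ^ (p + q)) = 1" "(\<Sum>i\<in>UNIV. (y $ i) ^ (p + q)) = 1"
    "\<And>i. row_form p q A x y i = t * (x $ i) ^ (p + q - 1)"
    "\<And>i. col_form p q A x y i = t * (y $ i) ^ (p + q - 1)"
proof -
  obtain a b u v where u: "\<And>i. u $ i > 0" and v: "\<And>i. v $ i > 0"
    and ab: "\<And>i. row_form p q A u v i = a * (u $ i) ^ (p + q - 1)"
      "\<And>i. col_form p q A u v i = b * (v $ i) ^ (p + q - 1)"
    by (rule positive_tensor_two_eigenvalues[OF A pq]) (rule that)
  have l: "p + q > 0" using pq by simp
  obtain c where c: "c > 0" "(\<Sum>i\<in>UNIV. (c * u $ i) ^ (p + q)) = 1"
    by (rule normalise_power_sum[OF u l])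
  obtain d where d: "d > 0" "(\<Sum>i\<in>UNIV. (d * v $ i) ^ (p + q)) = 1"
    by (rule normalise_power_sum[OF v l])
  define x y where "x = c *\<^sub>R u" and "y = d *\<^sub>R v"
  \<comment> \<open>The factors that homogeneity produces for the rescaled vectors.\<close>
  define s where "s = c ^ (p - 1) * d ^ q * a / c ^ (p + q - 1)"
  define t where "t = d ^ (q - 1) * c ^ p * b / d ^ (p + q - 1)"
  have row: "row_form p q A x y i = s * (x $ i) ^ (p + q - 1)" for i
    unfolding x_def y_def row_form_scale ab s_def using c(1) by (simp add: power_mult_distrib)
  have col: "col_form p q A x y i = t * (y $ i) ^ (p + q - 1)" for i
    unfolding x_def y_def row_form_scale ab t_def using d(1) by (simp add: power_mult_distrib)
  have norm: "(\<Sum>i\<in>UNIV. (x $ i) ^ (p + q)) = 1" "(\<Sum>i\<in>UNIV. (y $ i) ^ (p + q)) = 1"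
    using c d by (auto simp: x_def y_def)
  have pow: "z * (r * z ^ (p + q - 1)) = r * z ^ (p + q)" for r z :: real
    using pq by (simp add: power_eq_if[of z "p + q"])
  have st: "s = t"
    using euler_identity[OF pq, of x A y] norm unfolding row col pow
    by (simp only: sum_distrib_left[symmetric] mult_1_right)
  have "x $ i > 0" "y $ i > 0" for i using c(1) d(1) u v by (simp_all add: x_def y_def)
  thus ?thesis using norm row col[folded st] by (rule that)
qed

section \<open>The Perron singular value\<close>

lemma unit_power_sum_le_1:
  fixes x :: "real ^ 'n"
  assumes "\<And>i. x $ i > 0" "(\<Sum>i\<in>UNIV. (x $ i) ^ l) = 1" "l > 0"
  shows "x \<in> cbox 0 (\<chi> i. 1)"
proof -
  have "x $ i \<le> 1" for i
  proof -
    have "(x $ i) ^ l \<le> 1 ^ l"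
      using member_le_sum[of i UNIV "\<lambda>i. (x $ i) ^ l"] assms by (auto simp: less_imp_le)
    thus ?thesis using assms power_le_imp_le_base[of "x $ i" "l - 1" 1] by (cases l) auto
  qed
  thus ?thesis using assms(1) by (auto simp: mem_box_cart less_imp_le)
qed

text \<open>
  Eigenpairs of the tensors \<open>A + 1 / (n + 1)\<close> are super-pairs of \<open>A\<close>, so every lower bound of the
  super-pair factors passes to the limit of their eigenvalues. The limit vectors are nonzero by the
  normalisation, also when the limit eigenvalue is \<open>0\<close>, and so the limit is a singular value.
\<close>
lemma perron_singular_value:
  fixes A :: "'n::finite rtensor"
  assumes A: "nonneg_rtensor p q A" and pq: "p \<ge> 1" "q \<ge> 1"
  obtains t where "t \<ge> 0" "singular_value p q A (of_real t)"
    "\<And>c. (\<And>s u v. super_pair p q A s u v \<Longrightarrow> c \<le> s) \<Longrightarrow> c \<le> t"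
proof -
  define B where "B n is js = A is js + 1 / real (Suc n)" for n "is" js
  define eigen where "eigen n t x y \<longleftrightarrow> (\<forall>i. x $ i > 0) \<and> (\<forall>i. y $ i > 0) \<and>
    (\<Sum>i\<in>UNIV. (x $ i) ^ (p + q)) = 1 \<and> (\<Sum>i\<in>UNIV. (y $ i) ^ (p + q)) = 1 \<and>
    (\<forall>i. row_form p q (B n) x y i = t * (x $ i) ^ (p + q - 1)) \<and>
    (\<forall>i. col_form p q (B n) x y i = t * (y $ i) ^ (p + q - 1))" for n t x y
  have "\<exists>t x y. eigen n t x y" for n
  proof -
    have "\<forall>is\<in>tuples p UNIV. \<forall>js\<in>tuples q UNIV. B n is js > 0"
    proof (intro ballI)
      fix "is" js :: "'n list" assume "is \<in> tuples p UNIV" "js \<in> tuples q UNIV"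
      hence "A is js \<ge> 0" using A by (auto simp: nonneg_rtensor_def)
      moreover have "1 / real (Suc n) > 0" by simp
      ultimately show "B n is js > 0" unfolding B_def by linarith
    qed
    then obtain t x y where "\<And>i. x $ i > 0" "\<And>i. y $ i > 0"
      "(\<Sum>i\<in>UNIV. (x $ i) ^ (p + q)) = 1" "(\<Sum>i\<in>UNIV. (y $ i) ^ (p + q)) = 1"
      "\<And>i. row_form p q (B n) x y i = t * (x $ i) ^ (p + q - 1)"
      "\<And>i. col_form p q (B n) x y i = t * (y $ i) ^ (p + q - 1)"
      using pq by (rule positive_tensor_eigenpair) (rule that)
    thus ?thesis unfolding eigen_def by (intro exI[of _ t] exI[of _ x] exI[of _ y] conjI allI)
  qed
  hence "\<exists>t x y. \<forall>n. eigen n (t n) (x n) (y n)" by metis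
  then obtain t x y where eigen: "eigen n (t n) (x n) (y n)" for n by blast
  have pos: "x n $ i > 0" "y n $ i > 0"
    and norm: "(\<Sum>i\<in>UNIV. (x n $ i) ^ (p + q)) = 1" "(\<Sum>i\<in>UNIV. (y n $ i) ^ (p + q)) = 1"
    and row: "row_form p q (B n) (x n) (y n) i = t n * (x n $ i) ^ (p + q - 1)"
    and col: "col_form p q (B n) (x n) (y n) i = t n * (y n $ i) ^ (p + q - 1)" for n i
    using eigen[of n] unfolding eigen_def by blast+
  have "seq_compact (cbox 0 (\<chi> i. 1) \<times> cbox 0 (\<chi> i. (1::real)) :: ((real ^ 'n) \<times> (real ^ 'n)) set)"
    by (intro compact_imp_seq_compact compact_Times compact_cbox)
  moreover have "\<forall>n. (x n, y n) \<in> cbox 0 (\<chi> i. 1) \<times> cbox 0 (\<chi> i. 1)"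
    using unit_power_sum_le_1[OF pos(1) norm(1)] unit_power_sum_le_1[OF pos(2) norm(2)] pq by auto
  ultimately obtain z r where r: "strict_mono r" and lim: "((\<lambda>n. (x n, y n)) \<circ> r) \<longlonglongrightarrow> z"
    by (rule seq_compactE)
  define u v where "u = fst z" and "v = snd z"
  have xu: "(\<lambda>n. x (r n)) \<longlonglongrightarrow> u" and yv: "(\<lambda>n. y (r n)) \<longlonglongrightarrow> v"
    using tendsto_fst[OF lim] tendsto_snd[OF lim] by (simp_all add: u_def v_def o_def)
  have "(\<lambda>n. 1 / real (Suc n)) \<longlonglongrightarrow> 0" by (rule LIMSEQ_Suc[OF lim_1_over_n])
  hence inv: "(\<lambda>n. 1 / real (Suc (r n))) \<longlonglongrightarrow> 0"
    using LIMSEQ_subseq_LIMSEQ[OF _ r] by (fastforce simp: o_def)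
  have BA: "(\<lambda>n. B (r n) is js) \<longlonglongrightarrow> A is js" for "is" js
    using tendsto_add[OF tendsto_const inv, of "A is js"] by (simp add: B_def)
  hence BA': "(\<lambda>n. flip_tensor (B (r n)) is js) \<longlonglongrightarrow> flip_tensor A is js" for "is" js
    by (simp add: flip_tensor_def)
  have lrow: "(\<lambda>n. row_form p q (B (r n)) (x (r n)) (y (r n)) i) \<longlonglongrightarrow> row_form p q A u v i" for i
    by (intro tendsto_row_form xu yv BA)
  have lcol: "(\<lambda>n. col_form p q (B (r n)) (x (r n)) (y (r n)) i) \<longlonglongrightarrow> col_form p q A u v i" for i
    by (intro tendsto_row_form xu yv BA')
  \<comment> \<open>By the normalisation the eigenvalue is a continuous function of tensor and eigenpair, hence
    it converges together with them.\<close>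
  define T where "T = (\<Sum>i\<in>UNIV. u $ i * row_form p q A u v i)"
  have pow: "z * (s * z ^ (p + q - 1)) = s * z ^ (p + q)" for s z :: real
    using pq by (simp add: power_eq_if[of z "p + q"])
  have t_eq: "t n = (\<Sum>i\<in>UNIV. x n $ i * row_form p q (B n) (x n) (y n) i)" for n
    unfolding row pow by (simp only: sum_distrib_left[symmetric] norm mult_1_right)
  have tT: "(\<lambda>n. t (r n)) \<longlonglongrightarrow> T"
    unfolding t_eq T_def by (intro tendsto_intros lrow xu)
  have rowT: "row_form p q A u v i = T * (u $ i) ^ (p + q - 1)" for i
    using lrow[of i] unfolding row
    by (rule LIMSEQ_unique) (intro tendsto_intros tT xu)
  have colT: "col_form p q A u v i = T * (v $ i) ^ (p + q - 1)" for i
    using lcol[of i] unfolding col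
    by (rule LIMSEQ_unique) (intro tendsto_intros tT yv)
  have "(\<lambda>n. \<Sum>i\<in>UNIV. (x (r n) $ i) ^ (p + q)) \<longlonglongrightarrow> (\<Sum>i\<in>UNIV. (u $ i) ^ (p + q))"
    by (intro tendsto_intros xu)
  hence "(\<Sum>i\<in>UNIV. (u $ i) ^ (p + q)) = 1"
    unfolding norm by (metis LIMSEQ_unique tendsto_const)
  hence u: "u \<noteq> 0" using pq by (auto simp: power_0_left)
  have "(\<lambda>n. \<Sum>i\<in>UNIV. (y (r n) $ i) ^ (p + q)) \<longlonglongrightarrow> (\<Sum>i\<in>UNIV. (v $ i) ^ (p + q))"
    by (intro tendsto_intros yv)
  hence "(\<Sum>i\<in>UNIV. (v $ i) ^ (p + q)) = 1"
    unfolding norm by (metis LIMSEQ_unique tendsto_const)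
  hence v: "v \<noteq> 0" using pq by (auto simp: power_0_left)
  have le_row: "row_form p q A (x n) (y n) i \<le> row_form p q (B n) (x n) (y n) i" for n i
    unfolding row_form_def by (intro sum_mono)
      (auto simp: B_def intro!: mult_right_mono mult_nonneg_nonneg real_monom_nonneg less_imp_le[OF pos(1)] less_imp_le[OF pos(2)])
  have le_col: "col_form p q A (x n) (y n) i \<le> col_form p q (B n) (x n) (y n) i" for n i
    unfolding row_form_def by (intro sum_mono)
      (auto simp: B_def flip_tensor_def intro!: mult_right_mono mult_nonneg_nonneg real_monom_nonneg less_imp_le[OF pos(1)] less_imp_le[OF pos(2)])
  have super: "super_pair p q A (t n) (x n) (y n)" for n
    unfolding super_pair_def using pos le_row[of n] le_col[of n] by (auto simp: row col)
  have lower: "c \<le> T" if "\<And>s u v. super_pair p q A s u v \<Longrightarrow> c \<le> s" for c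
    by (rule LIMSEQ_le_const[OF tT]) (use that super in blast)
  \<comment> \<open>Nonnegativity of the limit is the case \<open>c = 0\<close> of \<open>lower\<close>.\<close>
  have "0 \<le> s" if s: "super_pair p q A s u v" for s u v
  proof -
    have "0 \<le> row_form p q A u v i" for i
      using s by (intro row_form_nonneg[OF A pq(1)]) (auto simp: super_pair_def less_imp_le)
    hence "0 \<le> s * (u $ i) ^ (p + q - 1)" "0 < (u $ i) ^ (p + q - 1)" for i
      using s by (auto simp: super_pair_def intro: order_trans)
    thus ?thesis by (meson linorder_not_less mult_neg_pos)
  qed
  hence "0 \<le> T" by (rule lower)
  thus ?thesis using singular_value_of_real[OF u v rowT colT] lower by (rule that)
qed

section \<open>The chain of bounds\<close>

theorem theorem6:
  fixes p q :: nat and A :: "'n::finite rtensor" and S :: "'n set"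
  assumes "p \<ge> 1" and "q \<ge> 1" and "CARD('n) \<ge> 2"
    and "nonneg_rtensor p q A"
    and "S \<noteq> {}" and "S \<noteq> UNIV"
  shows "L_bound p q A S \<le> Theta_bound p q A S \<and>
         Theta_bound p q A S \<le> largest_singular_value p q A \<and>
         largest_singular_value p q A \<le> Phi_bound p q A S \<and>
         Phi_bound p q A S \<le> U_bound p q A S"
proof -
  note A = \<open>nonneg_rtensor p q A\<close> \<open>p \<ge> 1\<close> \<open>q \<ge> 1\<close>
  note S = \<open>S \<noteq> {}\<close> \<open>S \<noteq> UNIV\<close>
  obtain t where t: "t \<ge> 0" "singular_value p q A (of_real t)"
    and min_max: "\<And>c. (\<And>s u v. super_pair p q A s u v \<Longrightarrow> c \<le> s) \<Longrightarrow> c \<le> t"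
    using perron_singular_value[OF A] by blast
  have max: "cmod \<mu> \<le> t" if \<mu>: "singular_value p q A \<mu>" for \<mu>
    using singular_value_sub_pair[OF A \<mu>] sub_pair_le_super_pair[OF A] min_max by metis
  have "largest_singular_value p q A = t"
    unfolding largest_singular_value_def
  proof (rule Greatest_equality)
    show "t \<in> cmod ` {\<mu>. singular_value p q A \<mu>}"
      using t by (intro image_eqI[of _ _ "of_real t"]) auto
  qed (use max in auto)
  moreover have "Theta_bound p q A S \<le> t"
    using super_pair_ge_Theta_bound[OF A _ S] by (rule min_max)
  moreover have "t \<le> Phi_bound p q A S"
    using singular_value_sub_pair[OF A t(2)] sub_pair_le_Phi_bound[OF A _ _ S] t(1)
    by (metis abs_of_nonneg norm_of_real)
  ultimately show ?thesis
    using L_bound_le_Theta_bound[OF A S] Phi_bound_le_U_bound[OF A S] by simp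
qed

end
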